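(* Let $f(x)=\sum_{k=0}^\infty a_k\tau_k(x;0)$ be a transcendental entire function of order $\sigma<\frac13$, let $\gamma\in(3,\frac1\sigma)$, and let $\delta>0$. Then there exists a set $E\subset[1,\infty)$ of finite logarithmic measure such that for every $h\in\mathbb{R}$, $\beta>0$ and $\omega\in(0,\beta)$, we have $$\sum_{k:\,|k-N|\ge\kappa}k^h|a_k\tau_k(r;0)| = o\left(\mu_{\mathrm W}(r;f)\,N^h\, b(N)^{\frac{\omega-1}{2}}\right)$$ as $r\to\infty$ with $r\in(0,\infty)\setminus E$, where $N=\nu_{\mathrm W}(r;f)$, $b(N):=\frac{1}{N\ln N(\ln\ln N)^{1+\delta}}$ and $\kappa=\left[\sqrt{\frac{\beta}{b(N)}\ln\frac{1}{b(N)}}\right]$.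
   Context: The order of an entire function $f$ is $\sigma=\limsup_{r\to\infty}\frac{\ln^+\ln^+M(r;f)}{\ln r}$, where $M(r;f)=\max_{|x|=r}|f(x)|$ and $\ln^+t=\max\{\ln t,0\}$ (with $\ln^+0=0$). If $\sigma=0$, then $\frac1\sigma$ means $+\infty$. Transcendental means not a polynomial. The Wilson basis at $0$ is $\tau_0(x;0)=1$ and $\tau_k(x;0)=\prod_{j=0}^{k-1}(-j^2-x)=(-1)^kx(x+1^2)\cdots(x+(k-1)^2)$ for $k\ge1$. Every entire function $f$ of order smaller than $\frac12$ has a unique expansion $f(x)=\sum_{k=0}^\infty a_k\tau_k(x;0)$ converging uniformly on compact subsets of $\mathbb{C}$; the $a_k$ are the coefficients of this expansion. For such $f\not\equiv0$ and $r>0$, the Wilson maximal term is $\mu_{\mathrm W}(r;f)=\max_{n\ge0}|a_n|\,r(r+1^2)\cdots(r+(n-1)^2)$ and the Wilson central index is $\nu_{\mathrm W}(r;f)=\max\{n\ge0: |a_n|\,r(r+1^2)\cdots(r+(n-1)^2)=\mu_{\mathrm W}(r;f)\}$ (the empty product for $n=0$ is $1$). For transcendental $f$, $N=\nu_{\mathrm W}(r;f)\to\infty$ as $r\to\infty$, so $b(N)$ and $\kappa$ are defined for all large $r$. $[\,\cdot\,]$ is the integer part. The sum runs over integers $k\ge0$ with $|k-N|\ge\kappa$; when $h<0$ the term $k=0$ is omitted, and $0^0=1$. The logarithmic measure of a measurable set $E\subseteq[1,\infty)$ is $\int_E\frac{dx}{x}$ (Lebesgue). *)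

theory Defs
  imports "HOL-Complex_Analysis.Complex_Analysis" "HOL-Library.Landau_Symbols"
begin

definition transcendental_entire :: "(complex \<Rightarrow> complex) \<Rightarrow> bool" where
  "transcendental_entire f \<longleftrightarrow> f holomorphic_on UNIV \<and> (\<nexists>p :: complex poly. f = poly p)"

definition max_modulus :: "(complex \<Rightarrow> complex) \<Rightarrow> real \<Rightarrow> real" where
  "max_modulus f r = (SUP x\<in>sphere 0 r. cmod (f x))"

(* Applied only to t \<ge> 0; the case t = 0 is the convention that this function vanishes at 0. *)
definition ln_plus :: "real \<Rightarrow> real" where
  "ln_plus t = (if t = 0 then 0 else max (ln t) 0)"

definition growth_order :: "(complex \<Rightarrow> complex) \<Rightarrow> ereal" where
  "growth_order f = Limsup at_top (\<lambda>r. ereal (ln_plus (ln_plus (max_modulus f r)) / ln r))"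

definition wilson_tau :: "nat \<Rightarrow> complex \<Rightarrow> complex" where
  "wilson_tau k x = (\<Prod>j<k. - (of_nat j)\<^sup>2 - x)"

definition wilson_expansion :: "(complex \<Rightarrow> complex) \<Rightarrow> (nat \<Rightarrow> complex) \<Rightarrow> bool" where
  "wilson_expansion f a \<longleftrightarrow>
     (\<forall>K. compact K \<longrightarrow>
        uniform_limit K (\<lambda>n x. \<Sum>k<n. a k * wilson_tau k x) f sequentially)"

(* The maximal term and the central index of f are expressed through the coefficients a of its
   expansion, which determine f and, by evaluation at the points -j^2, are determined by f. *)
definition wilson_term :: "(nat \<Rightarrow> complex) \<Rightarrow> real \<Rightarrow> nat \<Rightarrow> real" where
  "wilson_term a r n = cmod (a n) * (\<Prod>j<n. r + (real j)\<^sup>2)"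

(* For r > 0 the terms are the moduli of the terms of a convergent series, so they tend to 0:
   the supremum is attained, and, unless all a n vanish, at only finitely many indices. *)
definition wilson_max_term :: "(nat \<Rightarrow> complex) \<Rightarrow> real \<Rightarrow> real" where
  "wilson_max_term a r = (SUP n. wilson_term a r n)"

definition wilson_central_index :: "(nat \<Rightarrow> complex) \<Rightarrow> real \<Rightarrow> nat" where
  "wilson_central_index a r = Max {n. wilson_term a r n = wilson_max_term a r}"

definition log_measure :: "real set \<Rightarrow> ennreal" where
  "log_measure E = (\<integral>\<^sup>+x\<in>E. ennreal (1 / x) \<partial>lebesgue)"

definition wilson_b :: "real \<Rightarrow> nat \<Rightarrow> real" where
  "wilson_b \<delta> N = 1 / (real N * ln (real N) * (ln (ln (real N))) powr (1 + \<delta>))"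

definition wilson_kappa :: "real \<Rightarrow> real \<Rightarrow> nat \<Rightarrow> int" where
  "wilson_kappa \<delta> \<beta> N = \<lfloor>sqrt (\<beta> / wilson_b \<delta> N * ln (1 / wilson_b \<delta> N))\<rfloor>"

definition tail_indices :: "real \<Rightarrow> nat \<Rightarrow> int \<Rightarrow> nat set" where
  "tail_indices h N \<kappa> = {k. \<bar>int k - int N\<bar> \<ge> \<kappa> \<and> \<not> (h < 0 \<and> k = 0)}"

(* The case split implements 0^0 = 1, because 0 powr 0 = 0. *)
definition nat_rpow :: "nat \<Rightarrow> real \<Rightarrow> real" where
  "nat_rpow k h = (if h = 0 then 1 else real k powr h)"

end

theory Submission
  imports Defs "HOL-Real_Asymp.Real_Asymp"
begin

text \<open>
  The proof is the comparison method of Wiman-Valiron theory, adapted to the Wilson basis. Write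
  \<open>T\<^sub>k(r) = |a\<^sub>k| r (r + 1^2) \<dots> (r + (k-1)^2)\<close>, which is \<open>|a\<^sub>k \<tau>\<^sub>k(r)|\<close> for \<open>r > 0\<close>. Multiply \<open>T\<^sub>k\<close> by
  the product \<open>q\<^sub>0 \<dots> q\<^sub>k\<^sub>-\<^sub>1\<close> of slowly increasing bounded weights, and let \<open>n\<close> be the central index of
  the weighted terms at a radius \<open>\<rho>\<close>. At the slightly larger radius \<open>r\<close> given by
  \<open>r + n^2 = q\<^sub>n (\<rho> + n^2)\<close>, the quotient \<open>T\<^sub>k(r) / T\<^sub>n(r)\<close> is bounded by the product of the factors
  \<open>q\<^sub>n/q\<^sub>j\<close> (for \<open>k > n\<close>) or \<open>q\<^sub>j/q\<^sub>n\<close> (for \<open>k < n\<close>) over the indices \<open>j\<close> between \<open>n\<close> and \<open>k\<close>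
  (\<open>term_above_peak\<close>, \<open>term_below_peak\<close>). In particular \<open>n\<close> is then also the Wilson central index at
  \<open>r\<close>, and the terms decay away from it at a rate that depends on \<open>q\<close> alone.

  The radii that are not reached in this way form gaps, one for each increase of the central index
  of the weighted terms. Their logarithmic lengths are summable (\<open>shift_gap\<close>, \<open>normal_radii\<close>):
  the part caused by the change of \<open>q\<^sub>n\<close> telescopes because \<open>q\<close> is bounded; the part caused by the change
  of \<open>n^2\<close> is of size \<open>n/R\<close>, where \<open>R\<close> is the radius at which the index \<open>n + 1\<close> is reached.
  Since the order is below \<open>1/3\<close>, the coefficients are so small that \<open>R \<ge> (n+1)^3\<close> for large \<open>n\<close>
  (\<open>wilson_coefficients_small\<close>, \<open>peak_below_cube\<close>), and \<open>n/R\<close> is summable.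

  For \<open>q\<^sub>n = 2 - (ln ln n)^(-\<delta>/2)\<close>, up to an offset of \<open>n\<close>, the increments of \<open>q\<close> are
  \<open>1/(n ln n (ln ln n)^(1+\<delta>/2))\<close> up to a constant, which is larger than \<open>b(n)\<close> by an unbounded factor.
  At distance at least \<open>\<kappa>\<close> from the central index \<open>n\<close> the terms are therefore smaller than the maximal
  term by more than any power of \<open>n\<close> (\<open>tail_terms_superpolynomially_small\<close>), for every \<open>\<beta> > 0\<close>,
  whereas the comparison function is at least the maximal term times a fixed power of \<open>n\<close>.
\<close>

section \<open>Size of the Wilson coefficients\<close>

text \<open>
  The part of the \<open>n\<close>-th partial sum from index \<open>k\<close> on, divided by the common factor \<open>\<tau>\<^sub>k\<close>.
  These tails satisfy a first-order recursion, and the value at the node \<open>-k^2\<close> is \<open>a\<^sub>k\<close>; this is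
  Newton interpolation without divided differences or contour integrals.
\<close>
definition newton_tail :: "(nat \<Rightarrow> complex) \<Rightarrow> nat \<Rightarrow> nat \<Rightarrow> complex \<Rightarrow> complex" where
  "newton_tail a n k x = (\<Sum>m=k..<n. a m * (\<Prod>j=k..<m. - (of_nat j)\<^sup>2 - x))"

lemma newton_tail_0: "newton_tail a n 0 x = (\<Sum>k<n. a k * wilson_tau k x)"
  by (simp add: newton_tail_def wilson_tau_def atLeast0LessThan)

lemma newton_tail_rec:
  assumes "k < n"
  shows "newton_tail a n k x = a k + (- (of_nat k)\<^sup>2 - x) * newton_tail a n (Suc k) x"
proof -
  have "(\<Prod>j=k..<m. - (of_nat j)\<^sup>2 - x)
      = (- (of_nat k)\<^sup>2 - x) * (\<Prod>j=Suc k..<m. - (of_nat j)\<^sup>2 - x)" if "m \<in> {Suc k..<n}" for m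
    using that by (simp add: prod.atLeast_Suc_lessThan)
  then show ?thesis
    using assms unfolding newton_tail_def
    by (simp add: sum.atLeast_Suc_lessThan sum_distrib_left mult.left_commute)
qed

lemma newton_tail_at_node: "k < n \<Longrightarrow> newton_tail a n k (- (of_nat k)\<^sup>2) = a k"
  by (simp add: newton_tail_rec)

lemma newton_tail_holomorphic: "newton_tail a n k holomorphic_on S"
  unfolding newton_tail_def by (intro holomorphic_intros)

lemma maximum_modulus_disc:
  fixes g :: "complex \<Rightarrow> complex"
  assumes "g holomorphic_on UNIV" and "\<And>x. x \<in> sphere 0 R \<Longrightarrow> cmod (g x) \<le> B"
    and "0 < R" "z \<in> ball 0 R"
  shows "cmod (g z) \<le> B"
proof (rule maximum_modulus_frontier[where S = "ball 0 R" and f = g])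
  show "g holomorphic_on interior (ball 0 R)"
    using assms(1) by (rule holomorphic_on_subset) auto
  show "continuous_on (closure (ball 0 R)) g"
    using assms(1) holomorphic_on_imp_continuous_on continuous_on_subset by blast
qed (use assms in \<open>auto simp: frontier_ball\<close>)

text \<open>
  On the circle \<open>|x| = R\<close> the recursion \<open>g\<^sub>k = a\<^sub>k + (-k^2 - x) g\<^sub>k\<^sub>+\<^sub>1\<close> divides by something of modulus
  at least \<open>R - k^2\<close>. The constant \<open>a\<^sub>k = g\<^sub>k(-k^2)\<close> that has to be subtracted first is no larger
  than \<open>g\<^sub>k\<close> on the circle, by the maximum principle, so each step costs only a factor 2.
\<close>
lemma newton_tail_bound:
  assumes bound: "\<And>x. x \<in> sphere 0 R \<Longrightarrow> cmod (newton_tail a n 0 x) \<le> B"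
    and "k < n" "(real k)\<^sup>2 < R" "x \<in> sphere 0 R"
  shows "cmod (newton_tail a n k x) \<le> 2 ^ k * B / (\<Prod>j<k. R - (real j)\<^sup>2)"
  using assms(2-)
proof (induction k arbitrary: x)
  case 0
  then show ?case using bound by simp
next
  case (Suc k)
  define C where "C = 2 ^ k * B / (\<Prod>j<k. R - (real j)\<^sup>2)"
  have k2: "(real k)\<^sup>2 < R"
    using Suc.prems(2) by (smt (verit) of_nat_Suc of_nat_0_le_iff power_mono)
  have R: "R > 0" using k2 by (smt (verit) zero_le_power2)
  have C: "cmod (newton_tail a n k y) \<le> C" if "y \<in> sphere 0 R" for y
    unfolding C_def using Suc.IH Suc.prems(1) k2 that by simp
  have "cmod (newton_tail a n k (- (of_nat k)\<^sup>2)) \<le> C"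
    by (rule maximum_modulus_disc[OF newton_tail_holomorphic C R])
       (use k2 in \<open>auto simp: norm_power\<close>)
  then have ak: "cmod (a k) \<le> C"
    using Suc.prems(1) by (simp add: newton_tail_at_node)
  have "R - (real k)\<^sup>2 \<le> cmod (- (of_nat k)\<^sup>2 - x)"
    using norm_triangle_ineq2[of x "- (of_nat k)\<^sup>2"] Suc.prems(3)
    by (simp add: norm_power norm_minus_commute)
  then have "(R - (real k)\<^sup>2) * cmod (newton_tail a n (Suc k) x)
      \<le> cmod ((- (of_nat k)\<^sup>2 - x) * newton_tail a n (Suc k) x)"
    by (simp add: norm_mult mult_right_mono)
  also have "\<dots> = cmod (newton_tail a n k x - a k)"
    using newton_tail_rec[of k n a x] Suc.prems(1) by simp
  also have "\<dots> \<le> 2 * C"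
    using norm_triangle_ineq4[of "newton_tail a n k x" "a k"] C[OF Suc.prems(3)] ak by linarith
  finally have "cmod (newton_tail a n (Suc k) x) \<le> 2 * C / (R - (real k)\<^sup>2)"
    using k2 by (simp add: field_simps)
  also have "\<dots> = 2 ^ Suc k * B / (\<Prod>j<Suc k. R - (real j)\<^sup>2)"
    by (simp add: C_def)
  finally show ?case .
qed

lemma cmod_le_max_modulus:
  assumes "f holomorphic_on UNIV" "x \<in> sphere 0 R"
  shows "cmod (f x) \<le> max_modulus f R"
proof -
  have "continuous_on (sphere 0 R) f"
    using assms(1) holomorphic_on_imp_continuous_on continuous_on_subset by blast
  then have "compact ((\<lambda>x. cmod (f x)) ` sphere 0 R)"
    by (intro compact_continuous_image continuous_intros) auto
  then show ?thesis
    unfolding max_modulus_def using assms(2)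
    by (intro cSUP_upper compact_imp_bounded bounded_imp_bdd_above)
qed

text \<open>
  A partial sum that is within distance 1 of \<open>f\<close> on the circle is bounded there by
  \<open>M(R) + 1\<close>, and its \<open>k\<close>-th coefficient is \<open>a\<^sub>k\<close> as soon as it has more than \<open>k\<close> terms.
\<close>
lemma wilson_coefficient_bound:
  assumes "wilson_expansion f a" "f holomorphic_on UNIV" "(real k)\<^sup>2 < R"
  shows "cmod (a k) \<le> 2 ^ k * (max_modulus f R + 1) / (\<Prod>j<k. R - (real j)\<^sup>2)"
proof -
  have R: "R > 0" using assms(3) by (smt (verit) zero_le_power2)
  have "uniform_limit (sphere 0 R) (\<lambda>n x. \<Sum>k<n. a k * wilson_tau k x) f sequentially"
    using assms(1) by (auto simp: wilson_expansion_def)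
  then have "\<forall>\<^sub>F n in sequentially. \<forall>x\<in>sphere 0 R. dist (\<Sum>k<n. a k * wilson_tau k x) (f x) < 1"
    by (rule uniform_limitD) simp
  then have "\<forall>\<^sub>F n in sequentially. (\<forall>x\<in>sphere 0 R. dist (\<Sum>k<n. a k * wilson_tau k x) (f x) < 1) \<and> k < n"
    using eventually_gt_at_top[of k] by eventually_elim auto
  then obtain n where n: "k < n"
    and near: "\<And>x. x \<in> sphere 0 R \<Longrightarrow> dist (newton_tail a n 0 x) (f x) < 1"
    unfolding newton_tail_0 by (auto simp: eventually_sequentially)
  have S: "cmod (newton_tail a n 0 x) \<le> max_modulus f R + 1" if "x \<in> sphere 0 R" for x
    using near[OF that] cmod_le_max_modulus[OF assms(2) that] norm_triangle_ineq2[of "newton_tail a n 0 x" "f x"]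
    by (simp add: dist_norm)
  have "cmod (newton_tail a n k (- (of_nat k)\<^sup>2)) \<le> 2 ^ k * (max_modulus f R + 1) / (\<Prod>j<k. R - (real j)\<^sup>2)"
    by (rule maximum_modulus_disc[OF newton_tail_holomorphic newton_tail_bound[OF S n assms(3)] R])
       (use assms(3) in \<open>auto simp: norm_power\<close>)
  then show ?thesis using n by (simp add: newton_tail_at_node)
qed

lemma max_modulus_nonneg:
  assumes "f holomorphic_on UNIV" "R > 0"
  shows "max_modulus f R \<ge> 0"
  using cmod_le_max_modulus[OF assms(1), of "of_real R" R] assms(2)
  by (auto intro: order_trans[OF norm_ge_zero])

lemma max_modulus_le_exp_powr:
  assumes "growth_order f < ereal s" "f holomorphic_on UNIV"
  shows "\<forall>\<^sub>F R in at_top. max_modulus f R \<le> exp (R powr s)"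
proof -
  have "\<forall>\<^sub>F R in at_top. ereal (ln_plus (ln_plus (max_modulus f R)) / ln R) < ereal s"
    using assms(1) unfolding growth_order_def by (rule Limsup_lessD)
  then show ?thesis
    using eventually_gt_at_top[of 1]
  proof eventually_elim
    case (elim R)
    define M where "M = max_modulus f R"
    have "M \<ge> 0" using max_modulus_nonneg[OF assms(2)] elim by (simp add: M_def)
    have small: "ln_plus (ln_plus M) < s * ln R"
      using elim by (simp add: M_def divide_less_eq)
    have le: "t \<le> exp C" if "ln_plus t \<le> C" "t \<ge> 0" for t C :: real
    proof (cases "t = 0")
      case False
      then have "ln t \<le> C" "t > 0" using that by (auto simp: ln_plus_def)
      then show ?thesis by (metis exp_le_cancel_iff exp_ln)
    qed simp
    have "ln_plus M \<ge> 0" by (auto simp: ln_plus_def)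
    with small have "ln_plus M \<le> R powr s"
      using le[of "ln_plus M" "s * ln R"] elim by (simp add: powr_def)
    then show ?case using le \<open>M \<ge> 0\<close> by (simp add: M_def)
  qed
qed

text \<open>
  This is where the order enters. With order below \<open>s < 1/3\<close> the radius \<open>R = k^(1/s)\<close> makes
  \<open>M(R) \<le> exp k\<close>, a geometric factor, whereas \<open>R/k^3 \<rightarrow> \<infinity>\<close>. The constant 8 is what the factors
  \<open>q\<^sub>j \<le> 2\<close> and \<open>\<rho> + j^2 \<le> 2 k^3\<close> below require to leave a decaying geometric sequence.
\<close>
lemma wilson_coefficients_small:
  assumes "wilson_expansion f a" "f holomorphic_on UNIV" "growth_order f < ereal (1 / 3)"
  shows "\<forall>\<^sub>F k in sequentially. cmod (a k) \<le> (1 / (8 * real k ^ 3)) ^ k"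
proof -
  have "max (growth_order f) (ereal (1 / 4)) < ereal (1 / 3)" using assms(3) by simp
  then obtain s where s: "max (growth_order f) (ereal (1 / 4)) < ereal s" "ereal s < ereal (1 / 3)"
    using ereal_dense2 by blast
  then have s': "growth_order f < ereal s" "1 / 4 < s" "s < 1 / 3" by auto
  define R where "R k = real k powr (1 / s)" for k
  have "filterlim R at_top sequentially"
    unfolding R_def using s' by real_asymp
  then have "\<forall>\<^sub>F k in sequentially. max_modulus f (R k) \<le> exp (R k powr s)"
    using max_modulus_le_exp_powr[OF s'(1) assms(2)] by (rule eventually_compose_filterlim[rotated])
  moreover have "\<forall>\<^sub>F k in sequentially. R k - (real k)\<^sup>2 \<ge> 100 * real k ^ 3"
  proof -
    have "1 / s > 3" using s' by (simp add: field_simps)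
    then show ?thesis unfolding R_def by real_asymp
  qed
  ultimately show ?thesis using eventually_ge_at_top[of 1]
  proof eventually_elim
    case (elim k)
    have "100 * real k ^ 3 > 0" using elim by simp
    then have Rk: "(real k)\<^sup>2 < R k" using elim by linarith
    have "R k powr s = k" using elim s' by (simp add: R_def powr_powr)
    then have "max_modulus f (R k) + 1 \<le> exp (real k) + exp (real k)"
      using elim by (intro add_mono) auto
    then have M: "max_modulus f (R k) + 1 \<le> 2 * exp 1 ^ k"
      by (simp add: exp_of_nat_mult[symmetric])
    have "(\<Prod>j<k. 100 * real k ^ 3) \<le> (\<Prod>j<k. R k - (real j)\<^sup>2)"
    proof (rule prod_mono)
      fix j assume "j \<in> {..<k}"
      then have "(real j)\<^sup>2 \<le> (real k)\<^sup>2" by (intro power_mono) auto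
      then have "100 * real k ^ 3 \<le> R k - (real j)\<^sup>2" using elim by linarith
      then show "0 \<le> 100 * real k ^ 3 \<and> 100 * real k ^ 3 \<le> R k - (real j)\<^sup>2" by simp
    qed
    then have P: "(100 * real k ^ 3) ^ k \<le> (\<Prod>j<k. R k - (real j)\<^sup>2)" by simp
    have "cmod (a k) \<le> 2 ^ k * (max_modulus f (R k) + 1) / (\<Prod>j<k. R k - (real j)\<^sup>2)"
      by (rule wilson_coefficient_bound[OF assms(1,2) Rk])
    also have "\<dots> \<le> 2 ^ k * (2 * exp 1 ^ k) / (100 * real k ^ 3) ^ k"
      by (intro frac_le mult_left_mono M P) (use elim in auto)
    also have "\<dots> \<le> 2 ^ k * (2 ^ k * 3 ^ k) / (100 * real k ^ 3) ^ k"
    proof -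
      have "(2::real) \<le> 2 ^ k" using elim power_increasing[of 1 k "2::real"] by simp
      moreover have "exp 1 ^ k \<le> (3::real) ^ k" by (intro power_mono exp_le) auto
      ultimately show ?thesis using elim by (intro divide_right_mono mult_left_mono mult_mono) auto
    qed
    also have "\<dots> = (12 / (100 * real k ^ 3)) ^ k"
      by (simp only: power_divide[symmetric] power_mult_distrib[symmetric]) simp
    also have "\<dots> \<le> (1 / (8 * real k ^ 3)) ^ k"
      using elim by (intro power_mono) (auto simp: field_simps)
    finally show ?case .
  qed
qed

lemma wilson_coefficients_nonzero:
  assumes "wilson_expansion f a" "transcendental_entire f"
  shows "\<exists>k\<ge>n. a k \<noteq> 0"
proof (rule ccontr)
  assume "\<not> ?thesis"
  then have zero: "a k = 0" if "k \<ge> n" for k using that by auto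
  define p where "p = (\<Sum>k<n. smult (a k) (\<Prod>j<k. [:- (of_nat j)\<^sup>2, -1:]))"
  have p: "poly p x = (\<Sum>k<n. a k * wilson_tau k x)" for x
    by (simp add: p_def poly_sum poly_prod wilson_tau_def)
  have "f x = poly p x" for x
  proof -
    have "(\<lambda>m. \<Sum>k<m. a k * wilson_tau k x) \<longlonglongrightarrow> f x"
      using assms(1)[unfolded wilson_expansion_def, rule_format, of "{x}"] by simp
    moreover have "\<forall>\<^sub>F m in sequentially. (\<Sum>k<m. a k * wilson_tau k x) = poly p x"
      using eventually_ge_at_top[of n]
    proof eventually_elim
      case (elim m)
      then show ?case unfolding p
        by (intro sum.mono_neutral_right) (auto simp: zero)
    qed
    then have "(\<lambda>m. \<Sum>k<m. a k * wilson_tau k x) \<longlonglongrightarrow> poly p x"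
      by (rule tendsto_eventually)
    ultimately show ?thesis using LIMSEQ_unique by blast
  qed
  then show False using assms(2) by (auto simp: transcendental_entire_def)
qed

section \<open>Comparison with the terms of a weighted series\<close>

text \<open>
  The setting of the comparison method: weights \<open>q\<^sub>n\<close> increase within \<open>[1, 2]\<close>, and the \<open>n\<close>-th term
  is multiplied by \<open>q\<^sub>0 \<dots> q\<^sub>n\<^sub>-\<^sub>1\<close>. The more slowly \<open>q\<close> converges, the stronger is the
  resulting decay; boundedness of \<open>q\<close> is what keeps the exceptional set small.
\<close>
locale weighted_wilson_terms =
  fixes a :: "nat \<Rightarrow> complex" and q :: "nat \<Rightarrow> real"
  assumes nonzero: "\<And>n. \<exists>k\<ge>n. a k \<noteq> 0"
    and small: "\<forall>\<^sub>F k in sequentially. cmod (a k) \<le> (1 / (8 * real k ^ 3)) ^ k"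
    and q_mono: "\<And>i j. i \<le> j \<Longrightarrow> q i \<le> q j"
    and q_ge_1: "\<And>n. 1 \<le> q n" and q_le_2: "\<And>n. q n \<le> 2"
begin

lemma q_pos: "0 < q n"
  using q_ge_1[of n] by linarith

definition weighted_term :: "real \<Rightarrow> nat \<Rightarrow> real" where
  "weighted_term \<rho> n = wilson_term a \<rho> n * (\<Prod>j<n. q j)"

text \<open>
  Every weighted term of index at least \<open>n\<close> loses against one fixed term of smaller index. In other
  words, the central index of the weighted series is below \<open>n\<close>, expressed without choosing a maximum.
\<close>
definition peak_below :: "nat \<Rightarrow> real \<Rightarrow> bool" where
  "peak_below n \<rho> \<longleftrightarrow> (\<exists>m<n. \<forall>k\<ge>n. weighted_term \<rho> k < weighted_term \<rho> m)"

text \<open>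
  The radius at which the central index of the weighted series reaches \<open>n\<close>.
\<close>
definition threshold :: "nat \<Rightarrow> real" where
  "threshold n = Sup {\<rho>. 1 \<le> \<rho> \<and> peak_below n \<rho>}"

text \<open>
  The radius \<open>r\<close> determined by \<open>r + n^2 = q\<^sub>n (\<rho> + n^2)\<close>. Classically, for power series, one takes
  \<open>r = q\<^sub>n \<rho>\<close>. The additional \<open>n^2\<close> is chosen so that \<open>(r + j^2) / (\<rho> + j^2)\<close>, which is nonincreasing in \<open>j\<close>,
  is exactly \<open>q\<^sub>n\<close> at \<open>j = n\<close>; it is therefore at most \<open>q\<^sub>n\<close> above \<open>n\<close> and at least \<open>q\<^sub>n\<close> below \<open>n\<close>,
  which are the two inequalities that the comparison of terms needs.
\<close>
definition shift :: "nat \<Rightarrow> real \<Rightarrow> real" where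
  "shift n \<rho> = q n * (\<rho> + (real n)\<^sup>2) - (real n)\<^sup>2"

lemma wilson_term_split:
  "m \<le> k \<Longrightarrow> wilson_term a r k = cmod (a k) * (\<Prod>j<m. r + (real j)\<^sup>2) * (\<Prod>j=m..<k. r + (real j)\<^sup>2)"
  unfolding wilson_term_def
  by (metis (no_types, lifting) atLeast0LessThan mult.assoc prod.atLeastLessThan_concat zero_le)

lemma weighted_term_split:
  "m \<le> k \<Longrightarrow> weighted_term r k = cmod (a k) * (\<Prod>j<m. r + (real j)\<^sup>2)
      * (\<Prod>j=m..<k. r + (real j)\<^sup>2) * ((\<Prod>j<m. q j) * (\<Prod>j=m..<k. q j))"
  unfolding weighted_term_def
  by (simp add: wilson_term_split prod.atLeastLessThan_concat flip: atLeast0LessThan)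

lemma prod_shifted_pos: "0 < r \<Longrightarrow> 0 < (\<Prod>j\<in>S. r + (real j)\<^sup>2)"
  by (intro prod_pos) (simp add: add_pos_nonneg)

lemma prod_q_pos: "0 < (\<Prod>j\<in>S. q j)"
  by (intro prod_pos) (simp add: q_pos)

lemma weighted_term_pos: "0 < r \<Longrightarrow> a n \<noteq> 0 \<Longrightarrow> 0 < weighted_term r n"
  unfolding weighted_term_def wilson_term_def
  by (intro mult_pos_pos prod_shifted_pos prod_q_pos) auto

lemma weighted_term_mono:
  assumes "0 < r" "r \<le> s"
  shows "weighted_term r n \<le> weighted_term s n"
  unfolding weighted_term_def wilson_term_def
  by (intro mult_right_mono mult_left_mono prod_mono less_imp_le[OF prod_q_pos])
     (use assms in \<open>auto intro: add_nonneg_nonneg\<close>)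

text \<open>
  Cancelling the factors with \<open>j < m\<close> leaves a left-hand side that increases with \<open>r\<close>. Hence the
  central index of the weighted series can only grow.
\<close>
lemma weighted_term_less_iff:
  assumes "m \<le> k" "0 < r"
  shows "weighted_term r k < weighted_term r m
    \<longleftrightarrow> cmod (a k) * (\<Prod>j=m..<k. r + (real j)\<^sup>2) * (\<Prod>j=m..<k. q j) < cmod (a m)"
proof -
  define C where "C = (\<Prod>j<m. r + (real j)\<^sup>2) * (\<Prod>j<m. q j)"
  have "C > 0" unfolding C_def by (intro mult_pos_pos prod_shifted_pos prod_q_pos assms)
  have k: "weighted_term r k = (cmod (a k) * (\<Prod>j=m..<k. r + (real j)\<^sup>2) * (\<Prod>j=m..<k. q j)) * C"
    unfolding weighted_term_split[OF assms(1)] C_def by simp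
  have m: "weighted_term r m = cmod (a m) * C"
    unfolding weighted_term_def wilson_term_def C_def by simp
  show ?thesis unfolding k m by (rule mult_less_cancel_right_pos[OF \<open>C > 0\<close>])
qed

lemma peak_below_antimono:
  assumes "0 < r" "r \<le> s" "peak_below n s"
  shows "peak_below n r"
proof -
  obtain m where m: "m < n" "\<And>k. k \<ge> n \<Longrightarrow> weighted_term s k < weighted_term s m"
    using assms(3) by (auto simp: peak_below_def)
  have "weighted_term r k < weighted_term r m" if "k \<ge> n" for k
  proof -
    have mk: "m \<le> k" using m that by simp
    have "cmod (a k) * (\<Prod>j=m..<k. r + (real j)\<^sup>2) * (\<Prod>j=m..<k. q j)
        \<le> cmod (a k) * (\<Prod>j=m..<k. s + (real j)\<^sup>2) * (\<Prod>j=m..<k. q j)"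
      by (intro mult_right_mono mult_left_mono prod_mono less_imp_le[OF prod_q_pos])
         (use assms in \<open>auto intro: add_nonneg_nonneg\<close>)
    also have "\<dots> < cmod (a m)"
      using m(2)[OF that] weighted_term_less_iff[OF mk, of s] assms by simp
    finally show ?thesis using weighted_term_less_iff[OF mk assms(1)] by simp
  qed
  then show ?thesis using m(1) by (auto simp: peak_below_def)
qed

lemma peak_below_bounded:
  "bdd_above {\<rho>. 1 \<le> \<rho> \<and> peak_below n \<rho>}"
proof -
  obtain k where k: "k \<ge> n" "a k \<noteq> 0" using nonzero by blast
  define B where "B = (\<Sum>m<n. cmod (a m)) / cmod (a k)"
  have "\<rho> \<le> B" if \<rho>: "1 \<le> \<rho>" "peak_below n \<rho>" for \<rho>
  proof -
    obtain m where m: "m < n" "weighted_term \<rho> k < weighted_term \<rho> m"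
      using \<rho>(2) k by (auto simp: peak_below_def)
    have mk: "m < k" using m k by simp
    have one: "1 \<le> \<rho> + (real j)\<^sup>2" for j using \<rho>(1) by (simp add: add_increasing2)
    have "\<rho> \<le> (\<rho> + (real m)\<^sup>2) * (\<Prod>j=Suc m..<k. \<rho> + (real j)\<^sup>2)"
      using mult_mono[of \<rho> "\<rho> + (real m)\<^sup>2" 1 "\<Prod>j=Suc m..<k. \<rho> + (real j)\<^sup>2"]
        prod_ge_1[of "{Suc m..<k}" "\<lambda>j. \<rho> + (real j)\<^sup>2"] one \<rho>(1) by simp
    also have "\<dots> = (\<Prod>j=m..<k. \<rho> + (real j)\<^sup>2)"
      using mk by (simp add: prod.atLeast_Suc_lessThan)
    finally have 1: "\<rho> \<le> (\<Prod>j=m..<k. \<rho> + (real j)\<^sup>2)" .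
    have "\<rho> * cmod (a k) \<le> cmod (a k) * (\<Prod>j=m..<k. \<rho> + (real j)\<^sup>2) * (\<Prod>j=m..<k. q j)"
      using mult_mono[OF mult_left_mono[OF 1, of "cmod (a k)"] prod_ge_1[of "{m..<k}" q]] q_ge_1 \<rho>(1)
        prod_shifted_pos[of \<rho> "{m..<k}"]
      by (simp add: mult.commute)
    also have "\<dots> < cmod (a m)"
      using weighted_term_less_iff[of m k \<rho>] m mk \<rho>(1) by simp
    also have "\<dots> \<le> (\<Sum>m<n. cmod (a m))"
      using m by (intro member_le_sum) auto
    finally show ?thesis unfolding B_def using k by (simp add: field_simps)
  qed
  then show ?thesis by (intro bdd_aboveI[of _ B]) auto
qed

text \<open>
  For \<open>\<rho> = n^3 \<le> k^3\<close> the \<open>k\<close>-th weighted term is at most \<open>(2 k^3)^k 2^k / (8 k^3)^k = 1 / 2^k\<close>, while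
  any fixed nonzero term stays bounded below. So the central index reaches \<open>n\<close> only beyond \<open>n^3\<close>.
\<close>
lemma peak_below_cube: "\<forall>\<^sub>F n in sequentially. peak_below n (real n ^ 3)"
proof -
  obtain m where m: "a m \<noteq> 0" using nonzero by blast
  define C where "C = weighted_term 1 m"
  have "C > 0" unfolding C_def using m by (intro weighted_term_pos) auto
  have "(\<lambda>k. (1 / 2 :: real) ^ k) \<longlonglongrightarrow> 0" by (rule LIMSEQ_power_zero) simp
  then have "\<forall>\<^sub>F k in sequentially. (1 / 2) ^ k < C"
    using \<open>C > 0\<close> by (rule order_tendstoD(2))
  then have "\<forall>\<^sub>F k in sequentially. (1 / 2) ^ k < C \<and> cmod (a k) \<le> (1 / (8 * real k ^ 3)) ^ k"
    using small by eventually_elim simp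
  then obtain K where K: "\<And>k. k \<ge> K \<Longrightarrow> (1 / 2) ^ k < C"
    "\<And>k. k \<ge> K \<Longrightarrow> cmod (a k) \<le> (1 / (8 * real k ^ 3)) ^ k"
    by (auto simp: eventually_sequentially)
  show ?thesis
    using eventually_ge_at_top[of "K + m + 1"]
  proof eventually_elim
    case (elim n)
    have "weighted_term (real n ^ 3) k < weighted_term (real n ^ 3) m" if "k \<ge> n" for k
    proof -
      have k: "k \<ge> K" "k \<ge> 1" using that elim by auto
      have "(\<Prod>j<k. real n ^ 3 + (real j)\<^sup>2) \<le> (\<Prod>j<k. 2 * real k ^ 3)"
      proof (rule prod_mono)
        fix j assume "j \<in> {..<k}"
        then have "(real j)\<^sup>2 \<le> (real k)\<^sup>2" by (intro power_mono) auto
        also have "\<dots> \<le> real k ^ 3" using k by (intro power_increasing) auto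
        finally have "(real j)\<^sup>2 \<le> real k ^ 3" .
        moreover have "real n ^ 3 \<le> real k ^ 3" using that by (intro power_mono) auto
        ultimately have "real n ^ 3 + (real j)\<^sup>2 \<le> 2 * real k ^ 3" by linarith
        then show "0 \<le> real n ^ 3 + (real j)\<^sup>2 \<and> real n ^ 3 + (real j)\<^sup>2 \<le> 2 * real k ^ 3" by simp
      qed
      then have P: "(\<Prod>j<k. real n ^ 3 + (real j)\<^sup>2) \<le> (2 * real k ^ 3) ^ k" by simp
      have Q: "(\<Prod>j<k. q j) \<le> 2 ^ k"
        using prod_mono[of "{..<k}" q "\<lambda>_. 2"] q_le_2 less_imp_le[OF q_pos] by simp
      have "weighted_term (real n ^ 3) k \<le> (1 / (8 * real k ^ 3)) ^ k * (2 * real k ^ 3) ^ k * 2 ^ k"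
        unfolding weighted_term_def wilson_term_def
        by (intro mult_mono K P Q k prod_nonneg mult_nonneg_nonneg) (auto intro: less_imp_le[OF q_pos])
      also have "\<dots> = (1 / 2) ^ k"
        using k by (simp only: power_mult_distrib[symmetric]) simp
      also have "\<dots> < C" using K k by simp
      also have "C \<le> weighted_term (real n ^ 3) m"
        unfolding C_def using elim by (intro weighted_term_mono) auto
      finally show ?thesis .
    qed
    then show ?case using elim by (auto simp: peak_below_def intro!: exI[of _ m])
  qed
qed

lemma le_threshold: "1 \<le> \<rho> \<Longrightarrow> peak_below n \<rho> \<Longrightarrow> \<rho> \<le> threshold n"
  unfolding threshold_def using peak_below_bounded by (intro cSup_upper) auto

lemma peak_below_if_less_threshold:
  assumes "peak_below n \<rho>0" "1 \<le> \<rho>0" "0 < \<rho>" "\<rho> < threshold n"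
  shows "peak_below n \<rho>"
proof -
  obtain s where "s \<in> {\<rho>. 1 \<le> \<rho> \<and> peak_below n \<rho>}" "\<rho> < s"
    using assms less_cSupE[of \<rho> "{\<rho>. 1 \<le> \<rho> \<and> peak_below n \<rho>}"] unfolding threshold_def by blast
  then show ?thesis using peak_below_antimono[of \<rho> s n] assms by auto
qed

text \<open>
  If the central index is below \<open>n + 1\<close> but not below \<open>n\<close>, then it equals \<open>n\<close>: a maximal term among
  the first \<open>n + 1\<close> that exceeded the \<open>n\<close>-th would witness that the central index is below \<open>n\<close>.
\<close>
lemma weighted_peak:
  assumes "0 < \<rho>" "peak_below (Suc n) \<rho>" "\<not> peak_below n \<rho>"
  shows "k > n \<Longrightarrow> weighted_term \<rho> k < weighted_term \<rho> n"
    and "k \<le> n \<Longrightarrow> weighted_term \<rho> k \<le> weighted_term \<rho> n"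
proof -
  have "Max (weighted_term \<rho> ` {..n}) \<in> weighted_term \<rho> ` {..n}"
    by (intro Max_in) auto
  then obtain m where "m \<le> n" "weighted_term \<rho> m = Max (weighted_term \<rho> ` {..n})"
    by (metis atMost_iff imageE)
  then have m: "m \<le> n" "\<And>i. i \<le> n \<Longrightarrow> weighted_term \<rho> i \<le> weighted_term \<rho> m"
    by simp_all
  obtain m' where "m' \<le> n" "\<And>k. k > n \<Longrightarrow> weighted_term \<rho> k < weighted_term \<rho> m'"
    using assms(2) by (auto simp: peak_below_def less_Suc_eq_le Suc_le_eq)
  then have gt: "weighted_term \<rho> k < weighted_term \<rho> m" if "k > n" for k
    using m(2) that by (meson less_le_trans)
  have "weighted_term \<rho> m \<le> weighted_term \<rho> n"
  proof (rule ccontr)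
    assume *: "\<not> ?thesis"
    then have "m < n" using m(1) by (cases "m = n") auto
    moreover have "weighted_term \<rho> k < weighted_term \<rho> m" if "k \<ge> n" for k
      using gt[of k] * that by (cases "k = n") auto
    ultimately show False using assms(3) by (auto simp: peak_below_def)
  qed
  then show "k > n \<Longrightarrow> weighted_term \<rho> k < weighted_term \<rho> n"
    "k \<le> n \<Longrightarrow> weighted_term \<rho> k \<le> weighted_term \<rho> n"
    using gt m(2) by force+
qed

lemma le_shift: "0 < \<rho> \<Longrightarrow> \<rho> \<le> shift n \<rho>"
  using mult_right_mono[OF q_ge_1[of n], of "\<rho> + (real n)\<^sup>2"] unfolding shift_def by simp

lemma shift_factor_upper:
  assumes "n \<le> j"
  shows "shift n \<rho> + (real j)\<^sup>2 \<le> q n * (\<rho> + (real j)\<^sup>2)"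
proof -
  have "(real n)\<^sup>2 \<le> (real j)\<^sup>2" using assms by (intro power_mono) auto
  then have "(q n - 1) * (real n)\<^sup>2 \<le> (q n - 1) * (real j)\<^sup>2"
    using q_ge_1 by (intro mult_left_mono) auto
  then show ?thesis unfolding shift_def by (simp add: algebra_simps)
qed

lemma shift_factor_lower:
  assumes "j \<le> n"
  shows "q n * (\<rho> + (real j)\<^sup>2) \<le> shift n \<rho> + (real j)\<^sup>2"
proof -
  have "(real j)\<^sup>2 \<le> (real n)\<^sup>2" using assms by (intro power_mono) auto
  then have "(q n - 1) * (real j)\<^sup>2 \<le> (q n - 1) * (real n)\<^sup>2"
    using q_ge_1 by (intro mult_left_mono) auto
  then show ?thesis unfolding shift_def by (simp add: algebra_simps)
qed

text \<open>
  At the radius \<open>\<rho>\<close> the \<open>n\<close>-th weighted term is the largest. Passing to the shifted radius multiplies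
  the factors \<open>\<rho> + j^2\<close> by at most \<open>q\<^sub>n\<close>, and dividing out the weights restores \<open>1/q\<^sub>j\<close>; since \<open>q\<close> is
  increasing, every step away from \<open>n\<close> gains \<open>q\<^sub>n/q\<^sub>j \<le> 1\<close> (and \<open>q\<^sub>j/q\<^sub>n \<le> 1\<close> on the other side).
\<close>
lemma term_above_peak:
  assumes "0 < \<rho>" "n \<le> k" "weighted_term \<rho> k < weighted_term \<rho> n"
  shows "wilson_term a (shift n \<rho>) k < wilson_term a (shift n \<rho>) n * (\<Prod>j=n..<k. q n / q j)"
proof -
  define r where "r = shift n \<rho>"
  have "0 < r" using le_shift[OF assms(1), of n] assms(1) by (simp add: r_def)
  define Q where "Q = (\<Prod>j=n..<k. q n / q j)"
  have "Q > 0" unfolding Q_def by (intro prod_pos) (simp add: q_pos)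
  have "(\<Prod>j=n..<k. r + (real j)\<^sup>2) \<le> (\<Prod>j=n..<k. q n * (\<rho> + (real j)\<^sup>2))"
    using \<open>0 < r\<close> shift_factor_upper by (intro prod_mono) (auto simp: r_def)
  also have "\<dots> = (\<Prod>j=n..<k. (\<rho> + (real j)\<^sup>2) * q j * (q n / q j))"
    by (intro prod.cong) (use q_pos in \<open>auto simp: less_imp_neq[symmetric]\<close>)
  also have "\<dots> = (\<Prod>j=n..<k. \<rho> + (real j)\<^sup>2) * (\<Prod>j=n..<k. q j) * Q"
    unfolding Q_def by (simp only: prod.distrib)
  finally have "cmod (a k) * (\<Prod>j=n..<k. r + (real j)\<^sup>2)
      \<le> cmod (a k) * (\<Prod>j=n..<k. \<rho> + (real j)\<^sup>2) * (\<Prod>j=n..<k. q j) * Q"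
    unfolding mult.assoc by (rule mult_left_mono) simp
  also have "\<dots> < cmod (a n) * Q"
    using assms(3) weighted_term_less_iff[OF assms(2,1)] \<open>Q > 0\<close> by simp
  finally have "(\<Prod>j<n. r + (real j)\<^sup>2) * (cmod (a k) * (\<Prod>j=n..<k. r + (real j)\<^sup>2))
      < (\<Prod>j<n. r + (real j)\<^sup>2) * (cmod (a n) * Q)"
    using prod_shifted_pos[OF \<open>0 < r\<close>] by (rule mult_strict_left_mono)
  then show ?thesis
    unfolding r_def[symmetric] Q_def[symmetric] wilson_term_split[OF assms(2)]
    by (simp add: wilson_term_def mult_ac)
qed

lemma term_below_peak:
  assumes "0 < \<rho>" "k \<le> n" "weighted_term \<rho> k \<le> weighted_term \<rho> n"
  shows "wilson_term a (shift n \<rho>) k \<le> wilson_term a (shift n \<rho>) n * (\<Prod>j=k..<n. q j / q n)"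
proof -
  define r where "r = shift n \<rho>"
  have "0 < r" using le_shift[OF assms(1), of n] assms(1) by (simp add: r_def)
  define Q where "Q = (\<Prod>j=k..<n. q j / q n)"
  have "Q > 0" unfolding Q_def by (intro prod_pos) (simp add: q_pos)
  have "(\<Prod>j=k..<n. \<rho> + (real j)\<^sup>2) * (\<Prod>j=k..<n. q j) = (\<Prod>j=k..<n. (q n * (\<rho> + (real j)\<^sup>2)) * (q j / q n))"
    unfolding prod.distrib[symmetric]
    by (intro prod.cong) (use q_pos in \<open>auto simp: less_imp_neq[symmetric]\<close>)
  also have "\<dots> = (\<Prod>j=k..<n. q n * (\<rho> + (real j)\<^sup>2)) * Q"
    unfolding Q_def by (simp only: prod.distrib)
  also have "\<dots> \<le> (\<Prod>j=k..<n. r + (real j)\<^sup>2) * Q"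
    using \<open>Q > 0\<close> shift_factor_lower assms(1) less_imp_le[OF q_pos]
    by (intro mult_right_mono prod_mono) (auto simp: r_def)
  finally have *: "(\<Prod>j=k..<n. \<rho> + (real j)\<^sup>2) * (\<Prod>j=k..<n. q j) \<le> (\<Prod>j=k..<n. r + (real j)\<^sup>2) * Q" .
  have "cmod (a k) \<le> cmod (a n) * ((\<Prod>j=k..<n. \<rho> + (real j)\<^sup>2) * (\<Prod>j=k..<n. q j))"
    using assms(3) weighted_term_less_iff[OF assms(2,1)] by (simp add: not_less[symmetric] mult_ac)
  also have "\<dots> \<le> cmod (a n) * ((\<Prod>j=k..<n. r + (real j)\<^sup>2) * Q)"
    by (intro mult_left_mono *) auto
  finally have "cmod (a k) * (\<Prod>j<k. r + (real j)\<^sup>2)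
      \<le> cmod (a n) * ((\<Prod>j=k..<n. r + (real j)\<^sup>2) * Q) * (\<Prod>j<k. r + (real j)\<^sup>2)"
    by (rule mult_right_mono) (rule less_imp_le[OF prod_shifted_pos[OF \<open>0 < r\<close>]])
  then show ?thesis
    unfolding r_def[symmetric] Q_def[symmetric] wilson_term_split[OF assms(2), of r]
    by (simp add: wilson_term_def mult_ac)
qed

end

section \<open>Radii outside a set of finite logarithmic measure\<close>

lemma log_measure_interval:
  assumes "0 < u" "u \<le> v"
  shows "log_measure {u..v} \<le> ennreal ((v - u) / u)"
proof -
  have "log_measure {u..v} \<le> (\<integral>\<^sup>+x. ennreal (1 / u) * indicator {u..v} x \<partial>lebesgue)"
    unfolding log_measure_def
    by (intro nn_integral_mono) (use assms in \<open>auto simp: indicator_def intro!: ennreal_leI frac_le\<close>)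
  also have "\<dots> = ennreal (1 / u) * ennreal (v - u)"
    using assms by (simp add: nn_integral_cmult_indicator)
  also have "\<dots> = ennreal ((v - u) / u)"
    using assms by (simp add: ennreal_mult[symmetric])
  finally show ?thesis .
qed

lemma log_measure_UN_finite:
  fixes u v c :: "nat \<Rightarrow> real"
  assumes "\<And>n. 0 < u n" "\<And>n. u n \<le> v n" "\<And>n. (v n - u n) / u n \<le> c n" "summable c"
  shows "log_measure (\<Union>n. {u n..v n}) < \<infinity>"
proof -
  define M where "M = density lebesgue (\<lambda>x::real. ennreal (1 / x))"
  have [measurable]: "(\<lambda>x::real. ennreal (1 / x)) \<in> borel_measurable lebesgue"
    by (intro measurable_completion) measurable
  have M: "log_measure A = emeasure M A" if "A \<in> sets lebesgue" for A
    unfolding M_def log_measure_def using that by (simp add: emeasure_density)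
  have c: "0 \<le> c n" for n
    using assms(1,2,3)[of n] by (smt (verit) divide_nonneg_pos)
  have "log_measure (\<Union>n. {u n..v n}) = emeasure M (\<Union>n. {u n..v n})"
    by (rule M) auto
  also have "\<dots> \<le> (\<Sum>n. emeasure M {u n..v n})"
    by (rule emeasure_subadditive_countably) (auto simp: M_def)
  also have "\<dots> \<le> (\<Sum>n. ennreal (c n))"
  proof (intro suminf_le)
    fix n
    have "emeasure M {u n..v n} \<le> ennreal ((v n - u n) / u n)"
      using log_measure_interval[OF assms(1)[of n] assms(2)[of n]] M[of "{u n..v n}"] by simp
    also have "\<dots> \<le> ennreal (c n)" by (intro ennreal_leI assms)
    finally show "emeasure M {u n..v n} \<le> ennreal (c n)" .
  qed auto
  also have "\<dots> < \<infinity>"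
    using ennreal_suminf_neq_top[OF assms(4) c] by (simp add: less_top)
  finally show ?thesis .
qed

lemma quotient_le_exp:
  fixes x y :: real
  assumes "0 < x" "x \<le> y" "y \<le> 2"
  shows "x / y \<le> exp (- \<bar>y - x\<bar> / 2)"
proof -
  have abs: "\<bar>y - x\<bar> = y - x" using assms by simp
  have "(y - x) / 2 \<le> (y - x) / y" using assms by (intro divide_left_mono) auto
  moreover have "x / y = 1 - (y - x) / y" using assms by (simp add: field_simps)
  ultimately show ?thesis
    using exp_ge_add_one_self[of "- \<bar>y - x\<bar> / 2"] unfolding abs by linarith
qed

text \<open>
  Half the sum of the distances of the weights \<open>q\<^sub>j\<close> from \<open>q\<^sub>n\<close>, over the indices passed on the way
  from \<open>n\<close> to \<open>k\<close>. The half comes from \<open>x/y \<le> exp(-(y - x)/2)\<close> for \<open>x \<le> y \<le> 2\<close>.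
\<close>
definition decay_exponent :: "(nat \<Rightarrow> real) \<Rightarrow> nat \<Rightarrow> nat \<Rightarrow> real" where
  "decay_exponent q n k = (\<Sum>j=min k n..<max k n. \<bar>q j - q n\<bar> / 2)"

context weighted_wilson_terms
begin

lemma term_decay:
  assumes "0 < \<rho>" "peak_below (Suc n) \<rho>" "\<not> peak_below n \<rho>"
  shows "wilson_term a (shift n \<rho>) k \<le> wilson_term a (shift n \<rho>) n * exp (- decay_exponent q n k)"
proof -
  have T: "0 \<le> wilson_term a (shift n \<rho>) n"
    unfolding wilson_term_def using le_shift[OF assms(1), of n] assms(1)
    by (intro mult_nonneg_nonneg less_imp_le[OF prod_shifted_pos]) auto
  show ?thesis
  proof (cases "k \<le> n")
    case True
    have "(\<Prod>j=k..<n. q j / q n) \<le> (\<Prod>j=k..<n. exp (- (\<bar>q j - q n\<bar> / 2)))"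
      using quotient_le_exp[OF q_pos q_mono q_le_2] less_imp_le[OF q_pos]
      by (intro prod_mono) (auto simp: abs_minus_commute)
    also have "\<dots> = exp (- decay_exponent q n k)"
      using True by (simp add: decay_exponent_def exp_sum sum_negf[symmetric] del: sum_negf)
    finally have "(\<Prod>j=k..<n. q j / q n) \<le> exp (- decay_exponent q n k)" .
    then show ?thesis
      using term_below_peak[OF assms(1) True weighted_peak(2)[OF assms True]] mult_left_mono[OF _ T]
      by (meson order_trans)
  next
    case False
    have "(\<Prod>j=n..<k. q n / q j) \<le> (\<Prod>j=n..<k. exp (- (\<bar>q j - q n\<bar> / 2)))"
      using quotient_le_exp[OF q_pos q_mono q_le_2] less_imp_le[OF q_pos]
      by (intro prod_mono) auto
    also have "\<dots> = exp (- decay_exponent q n k)"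
      using False by (simp add: decay_exponent_def exp_sum sum_negf[symmetric] del: sum_negf)
    finally have "(\<Prod>j=n..<k. q n / q j) \<le> exp (- decay_exponent q n k)" .
    then show ?thesis
      using term_above_peak[OF assms(1) _ weighted_peak(1)[OF assms], of k] mult_left_mono[OF _ T] False
      by (meson order_trans less_imp_le not_le)
  qed
qed

lemma term_less_above:
  assumes "0 < \<rho>" "peak_below (Suc n) \<rho>" "\<not> peak_below n \<rho>" "n < k"
  shows "wilson_term a (shift n \<rho>) k < wilson_term a (shift n \<rho>) n"
proof -
  have T: "0 \<le> wilson_term a (shift n \<rho>) n"
    unfolding wilson_term_def using le_shift[OF assms(1), of n] assms(1)
    by (intro mult_nonneg_nonneg less_imp_le[OF prod_shifted_pos]) auto
  have "(\<Prod>j=n..<k. q n / q j) \<le> 1"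
    using q_mono q_pos less_imp_le[OF q_pos] by (intro prod_le_1) auto
  then have "wilson_term a (shift n \<rho>) n * (\<Prod>j=n..<k. q n / q j) \<le> wilson_term a (shift n \<rho>) n"
    using T by (rule mult_left_le)
  then show ?thesis
    using term_above_peak[OF assms(1) less_imp_le[OF assms(4)] weighted_peak(1)[OF assms]] by linarith
qed

text \<open>
  The index \<open>n\<close> is the largest one at which the maximum is attained because above \<open>n\<close> the inequality
  between the terms is strict.
\<close>
lemma central_index_at_peak:
  assumes "0 < \<rho>" "peak_below (Suc n) \<rho>" "\<not> peak_below n \<rho>"
  shows "wilson_central_index a (shift n \<rho>) = n"
    and "wilson_max_term a (shift n \<rho>) = wilson_term a (shift n \<rho>) n"
    and "0 < wilson_term a (shift n \<rho>) n"
proof -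
  define r where "r = shift n \<rho>"
  have "0 < r" using le_shift[OF assms(1), of n] assms(1) by (simp add: r_def)
  obtain k where k: "k \<ge> Suc n" "a k \<noteq> 0" using nonzero by blast
  have "0 \<le> wilson_term a r k"
    unfolding wilson_term_def by (intro mult_nonneg_nonneg less_imp_le[OF prod_shifted_pos] \<open>0 < r\<close>) auto
  then show pos: "0 < wilson_term a (shift n \<rho>) n"
    using term_less_above[OF assms, of k] k by (simp add: r_def)
  have le: "wilson_term a (shift n \<rho>) k \<le> wilson_term a (shift n \<rho>) n" for k
  proof -
    have "0 \<le> decay_exponent q n k" unfolding decay_exponent_def by (intro sum_nonneg) auto
    then have "exp (- decay_exponent q n k) \<le> 1" by simp
    then show ?thesis
      using term_decay[OF assms, of k] mult_left_le[of "exp (- decay_exponent q n k)"] pos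
      by (meson less_imp_le order_trans)
  qed
  show max: "wilson_max_term a (shift n \<rho>) = wilson_term a (shift n \<rho>) n"
    unfolding wilson_max_term_def by (rule cSup_eq_maximum) (use le in auto)
  have sub: "{k. wilson_term a (shift n \<rho>) k = wilson_max_term a (shift n \<rho>)} \<subseteq> {..n}"
    unfolding max using term_less_above[OF assms] by (force simp: not_le[symmetric])
  show "wilson_central_index a (shift n \<rho>) = n"
    unfolding wilson_central_index_def
    by (rule Max_eqI[OF finite_subset[OF sub]]) (use sub max in auto)
qed

lemma shift_alt: "shift n \<rho> = \<rho> + (q n - 1) * (\<rho> + (real n)\<^sup>2)"
  by (simp add: shift_def algebra_simps)

lemma shift_Suc_mono: "0 < \<rho> \<Longrightarrow> shift n \<rho> \<le> shift (Suc n) \<rho>"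
  unfolding shift_alt using q_mono[of n "Suc n"] q_ge_1[of n] q_ge_1[of "Suc n"]
  by (intro add_left_mono mult_mono power_mono) auto

lemma shift_less_iff: "shift n x < shift n y \<longleftrightarrow> x < y"
  unfolding shift_def using q_pos[of n] by simp

text \<open>
  When the central index of the weighted series jumps from \<open>n\<close> to \<open>n + 1\<close>, the shifted radius jumps
  as well and skips an interval. Its relative length has a part proportional to \<open>q\<^sub>n\<^sub>+\<^sub>1 - q\<^sub>n\<close>, which
  telescopes, and a part of size \<open>n/R\<close> from the moving offset \<open>n^2\<close> of the shift, which is summable
  because the jump happens beyond \<open>(n+1)^3\<close>.
\<close>
lemma shift_gap:
  assumes "0 < R" "real (Suc n) ^ 3 \<le> R"
  shows "(shift (Suc n) R - shift n R) / shift n R \<le> 2 * (q (Suc n) - q n) + 2 * (1 / real (Suc n) ^ 2)"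
proof -
  have "(real n)\<^sup>2 \<le> real (Suc n) ^ 2" by (intro power_mono) auto
  also have "\<dots> \<le> real (Suc n) ^ 3" by (intro power_increasing) auto
  finally have n2: "(real n)\<^sup>2 \<le> R" using assms(2) by linarith
  have dq: "0 \<le> q (Suc n) - q n" using q_mono[of n "Suc n"] by simp
  have "shift (Suc n) R - shift n R = (q (Suc n) - q n) * (R + (real n)\<^sup>2) + (q (Suc n) - 1) * (2 * real n + 1)"
    by (simp add: shift_alt algebra_simps power2_eq_square)
  also have "\<dots> \<le> (q (Suc n) - q n) * (2 * R) + 1 * (2 * real (Suc n))"
    using n2 dq q_ge_1[of "Suc n"] q_le_2[of "Suc n"] by (intro add_mono mult_mono mult_left_mono) auto
  finally have "(shift (Suc n) R - shift n R) / shift n R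
      \<le> ((q (Suc n) - q n) * (2 * R) + 1 * (2 * real (Suc n))) / R"
    using assms(1) le_shift[OF assms(1), of n] dq by (intro frac_le) auto
  also have "\<dots> = 2 * (q (Suc n) - q n) + 2 * real (Suc n) / R"
    using assms(1) by (simp add: field_simps)
  also have "2 * real (Suc n) / R \<le> 2 * real (Suc n) / real (Suc n) ^ 3"
    using assms by (intro divide_left_mono) auto
  also have "\<dots> = 2 * (1 / real (Suc n) ^ 2)"
    by (simp add: power3_eq_cube power2_eq_square del: of_nat_Suc)
  finally show ?thesis by simp
qed

lemma summable_q_diff: "summable (\<lambda>n. q (Suc n) - q n)"
proof -
  have "incseq q" using q_mono by (simp add: incseq_def)
  then obtain L where "q \<longlonglongrightarrow> L"
    by (rule incseq_convergent[of q 2]) (use q_le_2 in auto)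
  then show ?thesis by (rule telescope_summable)
qed

text \<open>
  The exceptional set consists of the skipped intervals. Any other large radius lies strictly between
  the shifted thresholds of \<open>n\<close> and \<open>n + 1\<close> for some \<open>n\<close>, both shifted by the same affine map of
  index \<open>n\<close>; it is thus the shift of a radius at which the weighted series has central index \<open>n\<close>.
\<close>
theorem normal_radii:
  obtains E where "E \<subseteq> {1..}" "E \<in> sets lebesgue" "log_measure E < \<infinity>"
    "\<And>m. \<forall>\<^sub>F r in at_top. r \<notin> E \<longrightarrow> (\<exists>n\<ge>m. wilson_central_index a r = n
        \<and> 0 < wilson_max_term a r
        \<and> (\<forall>k. wilson_term a r k \<le> wilson_max_term a r * exp (- decay_exponent q n k)))"
proof -
  obtain n1 where n1: "\<And>n. n \<ge> n1 \<Longrightarrow> peak_below n (real n ^ 3)"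
    using peak_below_cube by (auto simp: eventually_sequentially)
  define n0 where "n0 = max n1 1"
  have n0: "\<And>n. n \<ge> n0 \<Longrightarrow> peak_below n (real n ^ 3)" "n0 \<ge> 1"
    using n1 by (auto simp: n0_def)
  have thr: "real n ^ 3 \<le> threshold n" if "n \<ge> n0" for n
    using that n0 by (intro le_threshold) auto
  have cube: "1 \<le> real n ^ 3" if "n \<ge> n0" for n
    using that n0(2) by simp
  have thr_pos: "1 \<le> threshold n" if "n \<ge> n0" for n
    using thr[OF that] cube[OF that] by linarith
  define u where "u n = shift (n + n0) (threshold (Suc (n + n0)))" for n
  define v where "v n = shift (Suc (n + n0)) (threshold (Suc (n + n0)))" for n
  define E where "E = (\<Union>n. {u n..v n})"
  have u: "1 \<le> u n" for n
    using le_shift[of "threshold (Suc (n + n0))" "n + n0"] thr_pos[of "Suc (n + n0)"] by (simp add: u_def)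
  have uv: "u n \<le> v n" for n
    unfolding u_def v_def using thr_pos[of "Suc (n + n0)"] by (intro shift_Suc_mono) simp
  show thesis
  proof
    show "E \<subseteq> {1..}" using u unfolding E_def by (force intro: order_trans)
    show "E \<in> sets lebesgue" unfolding E_def by auto
    show "log_measure E < \<infinity>"
      unfolding E_def
    proof (rule log_measure_UN_finite)
      define c where "c n = 2 * (q (Suc n) - q n) + 2 * (1 / real (Suc n) ^ 2)" for n
      have "summable c"
        unfolding c_def
        using summable_q_diff inverse_squares_sums by (intro summable_add summable_mult) (auto simp: sums_iff add.commute)
      then show "summable (\<lambda>n. c (n + n0))" by (simp add: summable_iff_shift)
      show "(v n - u n) / u n \<le> c (n + n0)" for n
        unfolding u_def v_def c_def
        using thr_pos[of "Suc (n + n0)"] thr[of "Suc (n + n0)"] by (intro shift_gap) auto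
      show "0 < u n" for n using u[of n] by linarith
    qed (rule uv)
    fix m
    \<comment> \<open>The interval preceding index \<open>n\<close> must belong to the exceptional set, hence \<open>Suc n0\<close>.\<close>
    define m' where "m' = max m (Suc n0)"
    show "\<forall>\<^sub>F r in at_top. r \<notin> E \<longrightarrow> (\<exists>n\<ge>m. wilson_central_index a r = n
        \<and> 0 < wilson_max_term a r
        \<and> (\<forall>k. wilson_term a r k \<le> wilson_max_term a r * exp (- decay_exponent q n k)))"
      using eventually_ge_at_top[of "shift m' (threshold m')"]
    proof eventually_elim
      case (elim r)
      show ?case
      proof
        assume "r \<notin> E"
        \<comment> \<open>The index sought is the last one whose shifted threshold has been passed.\<close>
        define S where "S = {n. m' \<le> n \<and> shift n (threshold n) \<le> r}"
        have "S \<subseteq> {..nat \<lceil>r\<rceil>}"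
        proof
          fix n assume "n \<in> S"
          then have n: "n0 \<le> n" "shift n (threshold n) \<le> r" by (auto simp: S_def m'_def)
          have "real n \<le> real n ^ 3" using n n0 by (cases "n = 0") (auto intro: self_le_power)
          also have "\<dots> \<le> r"
            using thr[of n] le_shift[of "threshold n" n] thr_pos[of n] n by linarith
          finally show "n \<in> {..nat \<lceil>r\<rceil>}" by (simp add: le_nat_iff) linarith
        qed
        then have fin: "finite S" by (rule finite_subset) simp
        define n where "n = Max S"
        have "m' \<in> S" using elim by (simp add: S_def)
        then have "n \<in> S" unfolding n_def using fin by (intro Max_in) auto
        then have n: "m' \<le> n" "shift n (threshold n) \<le> r" by (auto simp: S_def)
        have "Suc n \<notin> S" using Max_ge[OF fin, of "Suc n"] by (auto simp: n_def)
        then have "r < shift (Suc n) (threshold (Suc n))" using n by (auto simp: S_def)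
        moreover have "r \<notin> {u (n - n0)..v (n - n0)}" using \<open>r \<notin> E\<close> by (auto simp: E_def)
        ultimately have hi: "r < shift n (threshold (Suc n))"
          using n(1) by (auto simp: u_def v_def m'_def)
        \<comment> \<open>The intervals are closed, so the upper end of the preceding one is excluded too.\<close>
        have "r \<notin> {u (n - 1 - n0)..v (n - 1 - n0)}" using \<open>r \<notin> E\<close> by (auto simp: E_def)
        then have "r \<noteq> v (n - 1 - n0)" using uv by auto
        moreover have "Suc (n - 1 - n0 + n0) = n" using n(1) by (auto simp: m'_def)
        ultimately have lo: "shift n (threshold n) < r"
          using n by (simp add: v_def)
        define \<rho> where "\<rho> = (r + (real n)\<^sup>2) / q n - (real n)\<^sup>2"
        have r: "r = shift n \<rho>" using q_pos[of n] by (simp add: \<rho>_def shift_def)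
        have \<rho>: "threshold n < \<rho>" "\<rho> < threshold (Suc n)"
          using lo hi unfolding r shift_less_iff by auto
        have n0n: "n0 \<le> n" using n by (simp add: m'_def)
        then have pos: "1 < \<rho>" using \<rho> thr_pos[of n] by simp
        have below: "peak_below (Suc n) \<rho>"
          using pos \<rho> n0n n0 cube[of "Suc n"] by (intro peak_below_if_less_threshold[OF n0(1)]) auto
        have not_below: "\<not> peak_below n \<rho>"
          using le_threshold[of \<rho> n] pos \<rho> by auto
        have "0 < \<rho>" using pos by simp
        note peak = this below not_below
        show "\<exists>n\<ge>m. wilson_central_index a r = n \<and> 0 < wilson_max_term a r
            \<and> (\<forall>k. wilson_term a r k \<le> wilson_max_term a r * exp (- decay_exponent q n k))"
          unfolding r using central_index_at_peak[OF peak] term_decay[OF peak] n(1)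
          by (intro exI[of _ n]) (auto simp: m'_def)
      qed
    qed
  qed
qed

end

section \<open>Weights converging at the iterated-logarithmic rate\<close>

text \<open>
  The increments of this bounded function are of the order \<open>1/(x ln x (ln ln x)^(1+\<epsilon>))\<close>. With
  \<open>\<epsilon> = \<delta>/2\<close> they exceed every multiple of \<open>b(x)\<close> eventually, so that no care with constants is
  needed. The offset \<open>exp (exp 1)\<close> makes the iterated logarithm at least 1 on \<open>[0, \<infinity>)\<close>.
\<close>
definition iterated_log_weight :: "real \<Rightarrow> real \<Rightarrow> real" where
  "iterated_log_weight \<epsilon> x = 2 - ln (ln (x + exp (exp 1))) powr - \<epsilon>"

text \<open>
  The derivative of \<open>iterated_log_weight\<close>.
\<close>
definition iterated_log_slope :: "real \<Rightarrow> real \<Rightarrow> real" where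
  "iterated_log_slope \<epsilon> x = \<epsilon> * ln (ln (x + exp (exp 1))) powr (- \<epsilon> - 1)
     / (ln (x + exp (exp 1)) * (x + exp (exp 1)))"

lemma ln_ln_shifted_ge_1:
  fixes x :: real
  assumes "0 \<le> x"
  shows "1 \<le> ln (ln (x + exp (exp 1)))" "1 < ln (x + exp (exp 1))" "1 < x + exp (exp 1)"
proof -
  have "1 < exp (exp (1::real))" by simp
  then show "1 < x + exp (exp 1)" using assms by linarith
  have "exp 1 \<le> ln (x + exp (exp 1))"
    using assms by (subst ln_ge_iff) (auto intro: add_nonneg_pos)
  moreover have "1 < exp (1::real)" by simp
  ultimately show "1 < ln (x + exp (exp 1))" by linarith
  then show "1 \<le> ln (ln (x + exp (exp 1)))"
    using \<open>exp 1 \<le> ln (x + exp (exp 1))\<close> by (subst ln_ge_iff) auto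
qed

lemma iterated_log_weight_deriv:
  assumes "0 \<le> x"
  shows "(iterated_log_weight \<epsilon> has_real_derivative iterated_log_slope \<epsilon> x) (at x)"
proof -
  have "x + exp (exp 1) > 0" using assms by (simp add: add_nonneg_pos)
  then show ?thesis
    unfolding iterated_log_weight_def[abs_def] iterated_log_slope_def
    using ln_ln_shifted_ge_1[OF assms]
    by (auto intro!: derivative_eq_intros simp: field_simps)
qed

lemma iterated_log_slope_pos: "0 < \<epsilon> \<Longrightarrow> 0 \<le> x \<Longrightarrow> 0 < iterated_log_slope \<epsilon> x"
  using ln_ln_shifted_ge_1[of x] unfolding iterated_log_slope_def
  by (intro divide_pos_pos mult_pos_pos) (auto simp: add_nonneg_pos)

lemma iterated_log_slope_antimono:
  assumes "0 < \<epsilon>" "0 \<le> x" "x \<le> y"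
  shows "iterated_log_slope \<epsilon> y \<le> iterated_log_slope \<epsilon> x"
proof -
  have pos: "x + exp (exp 1) > 0" using assms by (simp add: add_nonneg_pos)
  have ln: "ln (x + exp (exp 1)) \<le> ln (y + exp (exp 1))"
    using pos assms by simp
  have lnln: "ln (ln (x + exp (exp 1))) \<le> ln (ln (y + exp (exp 1)))"
    using ln ln_ln_shifted_ge_1[OF assms(2)] by simp
  have "ln (ln (y + exp (exp 1))) powr (- \<epsilon> - 1) \<le> ln (ln (x + exp (exp 1))) powr (- \<epsilon> - 1)"
    using ln_ln_shifted_ge_1[OF assms(2)] lnln assms(1) by (intro powr_mono2') auto
  then show ?thesis
    unfolding iterated_log_slope_def
    using ln pos ln_ln_shifted_ge_1[OF assms(2)] assms
    by (intro frac_le mult_mono mult_left_mono mult_pos_pos mult_nonneg_nonneg) auto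
qed

text \<open>
  The weight is concave, so the slope at \<open>z\<close> bounds all difference quotients to the left of \<open>z\<close>.
\<close>
lemma iterated_log_weight_increment:
  assumes "0 < \<epsilon>" "0 \<le> x" "x \<le> y" "y \<le> z"
  shows "iterated_log_slope \<epsilon> z * (y - x) \<le> iterated_log_weight \<epsilon> y - iterated_log_weight \<epsilon> x"
proof (cases "x = y")
  case False
  then have "x < y" using assms by simp
  then obtain w where w: "x < w" "w < y"
    "iterated_log_weight \<epsilon> y - iterated_log_weight \<epsilon> x = (y - x) * iterated_log_slope \<epsilon> w"
    using MVT2[of x y "iterated_log_weight \<epsilon>" "iterated_log_slope \<epsilon>"]
      iterated_log_weight_deriv assms by force
  have "iterated_log_slope \<epsilon> z \<le> iterated_log_slope \<epsilon> w"
    using w assms by (intro iterated_log_slope_antimono) auto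
  then show ?thesis unfolding w(3) using \<open>x < y\<close> by (simp add: mult.commute mult_left_mono)
qed simp

lemma iterated_log_weight_mono:
  assumes "0 < \<epsilon>" "0 \<le> x" "x \<le> y"
  shows "iterated_log_weight \<epsilon> x \<le> iterated_log_weight \<epsilon> y"
  using iterated_log_weight_increment[OF assms order_refl] iterated_log_slope_pos[of \<epsilon> y] assms
  by (smt (verit) mult_nonneg_nonneg)

lemma iterated_log_weight_bounds:
  assumes "0 < \<epsilon>" "0 \<le> x"
  shows "1 \<le> iterated_log_weight \<epsilon> x" "iterated_log_weight \<epsilon> x \<le> 2"
proof -
  have "ln (ln (x + exp (exp 1))) powr - \<epsilon> \<le> ln (ln (x + exp (exp 1))) powr 0"
    using ln_ln_shifted_ge_1[OF assms(2)] assms by (intro powr_mono) auto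
  then show "1 \<le> iterated_log_weight \<epsilon> x"
    using ln_ln_shifted_ge_1[OF assms(2)] by (simp add: iterated_log_weight_def)
qed (simp add: iterated_log_weight_def)

lemma slope_dominates_b:
  assumes "0 < \<delta>"
  shows "\<forall>\<^sub>F N in sequentially. C * wilson_b \<delta> N \<le> iterated_log_slope (\<delta> / 2) (2 * real N)"
  using assms unfolding wilson_b_def iterated_log_slope_def by real_asymp

lemma slope_dominates_powr:
  assumes "0 < \<epsilon>"
  shows "\<forall>\<^sub>F N in sequentially. C \<le> sqrt (real N) * real N * iterated_log_slope \<epsilon> (2 * real N)"
  using assms unfolding iterated_log_slope_def by real_asymp

lemma wilson_b_bounds:
  assumes "0 < \<delta>"
  shows "\<forall>\<^sub>F N in sequentially. 1 / real N ^ 2 \<le> wilson_b \<delta> N"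
    and "\<forall>\<^sub>F N in sequentially. wilson_b \<delta> N \<le> 1 / real N"
  using assms unfolding wilson_b_def by real_asymp+

lemma sum_nat_interval: "(\<Sum>j=k..<k + d. real j) = real d * real k + real d * (real d - 1) / 2"
  by (induction d) (auto simp: field_simps)

text \<open>
  For indices up to \<open>2n\<close> the distances \<open>|q\<^sub>j - q\<^sub>n|\<close> grow at least linearly in \<open>|j - n|\<close>, so the
  decay is Gaussian.
\<close>
lemma decay_exponent_near:
  fixes \<epsilon> :: real
  defines "q \<equiv> \<lambda>n. iterated_log_weight \<epsilon> (real n)"
  assumes "0 < \<epsilon>" "k \<le> 2 * n"
  defines "d \<equiv> \<bar>real k - real n\<bar>"
  shows "iterated_log_slope \<epsilon> (2 * real n) * (d * (d - 1)) / 4 \<le> decay_exponent q n k"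
proof -
  define s where "s = iterated_log_slope \<epsilon> (2 * real n)"
  have s: "0 < s" unfolding s_def using assms by (intro iterated_log_slope_pos) auto
  show ?thesis
  proof (cases "k \<le> n")
    case True
    define e where "e = n - k"
    have n: "n = k + e" and d: "d = real e" using True by (auto simp: e_def d_def)
    have "s * (d * (d - 1)) / 4 \<le> s * (d * (d + 1)) / 4"
      using s by (intro divide_right_mono mult_left_mono) (auto simp: d_def)
    also have "\<dots> = (\<Sum>j=k..<n. s * (real n - real j) / 2)"
      unfolding sum_divide_distrib[symmetric] sum_distrib_left[symmetric] sum_subtractf n sum_nat_interval
      by (simp add: d algebra_simps) (simp add: field_simps)
    also have "\<dots> \<le> (\<Sum>j=k..<n. \<bar>q j - q n\<bar> / 2)"
    proof (intro sum_mono divide_right_mono)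
      fix j assume "j \<in> {k..<n}"
      then show "s * (real n - real j) \<le> \<bar>q j - q n\<bar>"
        using iterated_log_weight_increment[of \<epsilon> "real j" "real n" "2 * real n"] assms
        by (simp add: s_def)
    qed simp
    also have "\<dots> = decay_exponent q n k" using True by (simp add: decay_exponent_def)
    finally show ?thesis by (simp add: s_def)
  next
    case False
    define e where "e = k - n"
    have k: "k = n + e" and d: "d = real e" using False by (auto simp: e_def d_def)
    have "s * (d * (d - 1)) / 4 = (\<Sum>j=n..<k. s * (real j - real n) / 2)"
      unfolding sum_divide_distrib[symmetric] sum_distrib_left[symmetric] sum_subtractf k sum_nat_interval
      by (simp add: d algebra_simps)
    also have "\<dots> \<le> (\<Sum>j=n..<k. \<bar>q j - q n\<bar> / 2)"
    proof (intro sum_mono divide_right_mono)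
      fix j assume "j \<in> {n..<k}"
      then show "s * (real j - real n) \<le> \<bar>q j - q n\<bar>"
        using iterated_log_weight_increment[of \<epsilon> "real n" "real j" "2 * real n"] assms
        by (simp add: s_def)
    qed simp
    also have "\<dots> = decay_exponent q n k" using False by (simp add: decay_exponent_def)
    finally show ?thesis by (simp add: s_def)
  qed
qed

text \<open>
  Beyond \<open>2n\<close> the distances \<open>|q\<^sub>j - q\<^sub>n|\<close> stop growing but stay above their value at \<open>2n\<close>, which
  gives exponential decay in \<open>k\<close>.
\<close>
lemma decay_exponent_far:
  fixes \<epsilon> :: real
  defines "q \<equiv> \<lambda>n. iterated_log_weight \<epsilon> (real n)"
  assumes "0 < \<epsilon>" "2 * n \<le> k" "2 \<le> n"
  shows "iterated_log_slope \<epsilon> (2 * real n) * real n * real k / 16 \<le> decay_exponent q n k"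
proof -
  define s where "s = iterated_log_slope \<epsilon> (2 * real n)"
  have s: "0 < s" unfolding s_def using assms by (intro iterated_log_slope_pos) auto
  have "2 * real n \<le> real k" "2 \<le> real n" using assms by simp_all
  then have "real k / 16 \<le> (real n - 1) / 4 + (real k - 2 * real n) / 2" by argo
  then have "s * real n * (real k / 16) \<le> s * real n * ((real n - 1) / 4 + (real k - 2 * real n) / 2)"
    using s by (intro mult_left_mono) auto
  also have "\<dots> = s * (real n * (real n - 1)) / 4 + (\<Sum>j=2*n..<k. s * real n / 2)"
    using assms by (simp add: of_nat_diff field_simps)
  also have "\<dots> \<le> (\<Sum>j=n..<2*n. \<bar>q j - q n\<bar> / 2) + (\<Sum>j=2*n..<k. \<bar>q j - q n\<bar> / 2)"
  proof (intro add_mono sum_mono divide_right_mono)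
    show "s * (real n * (real n - 1)) / 4 \<le> (\<Sum>j=n..<2*n. \<bar>q j - q n\<bar> / 2)"
      using decay_exponent_near[of \<epsilon> "2 * n" n] assms by (simp add: s_def q_def decay_exponent_def)
    fix j assume j: "j \<in> {2*n..<k}"
    have "s * real n \<le> q (2 * n) - q n"
      using iterated_log_weight_increment[of \<epsilon> "real n" "2 * real n" "2 * real n"] assms
      by (simp add: s_def q_def)
    also have "\<dots> \<le> \<bar>q j - q n\<bar>"
      using iterated_log_weight_mono[of \<epsilon> "2 * real n" "real j"] j assms by (simp add: q_def)
    finally show "s * real n \<le> \<bar>q j - q n\<bar>" .
  qed simp
  also have "\<dots> = decay_exponent q n k"
    using assms by (simp add: decay_exponent_def sum.atLeastLessThan_concat)
  finally show ?thesis by (simp add: s_def)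
qed

text \<open>
  For \<open>|k - n| \<ge> \<kappa>\<close> and \<open>k \<le> 2n\<close> the Gaussian exponent is about \<open>s \<kappa>^2\<close>, with \<open>\<kappa>^2\<close> about
  \<open>(\<beta>/b) ln (1/b) \<ge> (\<beta>/b) ln n\<close>. Since \<open>s/b \<rightarrow> \<infinity>\<close> this beats \<open>p ln n\<close> for every \<open>p\<close>. For \<open>k > 2n\<close>
  the exponent is at least a multiple of \<open>s n k\<close>, which exceeds every multiple of \<open>sqrt k\<close> and
  hence of \<open>ln k\<close>.
\<close>
lemma tail_terms_superpolynomially_small:
  fixes \<delta> \<beta> p :: real
  defines "q \<equiv> \<lambda>n. iterated_log_weight (\<delta> / 2) (real n)"
  assumes "0 < \<delta>" "0 < \<beta>" "0 < p"
  shows "\<forall>\<^sub>F n in sequentially. \<forall>k. wilson_kappa \<delta> \<beta> n \<le> \<bar>int k - int n\<bar> \<longrightarrow>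
    real (k + 1) powr p * exp (- decay_exponent q n k) \<le> real n powr - p"
proof -
  have "\<forall>\<^sub>F n in sequentially. 16 \<le> \<beta> * real n * ln (real n)"
    using assms by real_asymp
  then show ?thesis
    using slope_dominates_b[OF assms(2), of "48 * p / \<beta>"]
      slope_dominates_powr[OF half_gt_zero[OF assms(2)], of "64 * p"] wilson_b_bounds[OF assms(2)] eventually_ge_at_top[of 3]
  proof eventually_elim
    case (elim n)
    define s where "s = iterated_log_slope (\<delta> / 2) (2 * real n)"
    define b where "b = wilson_b \<delta> n"
    have n: "3 \<le> n" by fact
    have s: "48 * p / \<beta> * b \<le> s" "64 * p \<le> sqrt (real n) * real n * s"
      using elim assms by (auto simp: s_def b_def)
    have "0 < 1 / real n ^ 2" using n by simp
    then have b: "0 < b" "b \<le> 1 / real n" using elim unfolding b_def by linarith+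
    have ln_n: "0 < ln (real n)" using n by simp
    show ?case
    proof (intro allI impI)
      fix k assume k: "wilson_kappa \<delta> \<beta> n \<le> \<bar>int k - int n\<bar>"
      have "p * ln (real (k + 1)) + p * ln (real n) \<le> decay_exponent q n k"
      proof (cases "k \<le> 2 * n")
        case True
        have "real (k + 1) \<le> real n ^ 2"
        proof -
          have "real (k + 1) \<le> 2 * real n + 1" using True by simp
          also have "\<dots> \<le> 3 * real n" using n by simp
          also have "\<dots> \<le> real n ^ 2" using n by (simp add: power2_eq_square)
          finally show ?thesis .
        qed
        then have "ln (real (k + 1)) \<le> ln (real n ^ 2)" by (subst ln_le_cancel_iff) (use n in auto)
        also have "\<dots> = 2 * ln (real n)" using n by (simp add: ln_realpow)
        finally have lhs: "p * ln (real (k + 1)) + p * ln (real n) \<le> 3 * p * ln (real n)"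
          using assms(4) mult_left_mono[of "ln (real (k + 1))" "2 * ln (real n)" p] by simp
        define X where "X = sqrt (\<beta> / b * ln (1 / b))"
        have "real n \<le> 1 / b" using b n by (simp add: field_simps)
        then have "ln (real n) \<le> ln (1 / b)" using n b by simp
        then have Y: "\<beta> / b * ln (real n) \<le> \<beta> / b * ln (1 / b)"
          using b assms by (intro mult_left_mono) auto
        have "16 \<le> \<beta> * real n * ln (real n)" by fact
        also have "\<dots> \<le> \<beta> / b * ln (real n)"
          using \<open>real n \<le> 1 / b\<close> assms(3) ln_n mult_left_mono[of "real n" "1 / b" \<beta>]
          by (intro mult_right_mono) auto
        finally have "16 \<le> \<beta> / b * ln (1 / b)" using Y by linarith
        then have "sqrt (4 ^ 2) \<le> X" unfolding X_def by (subst real_sqrt_le_iff) simp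
        then have X4: "4 \<le> X" by simp
        have X2: "\<beta> / b * ln (real n) \<le> X ^ 2" using Y \<open>16 \<le> \<beta> / b * ln (1 / b)\<close> by (simp add: X_def)
        define d where "d = \<bar>real k - real n\<bar>"
        have "real_of_int \<lfloor>X\<rfloor> \<le> d"
          using k unfolding wilson_kappa_def X_def b_def d_def by linarith
        then have d: "X - 1 \<le> d" by linarith
        \<comment> \<open>Since \<open>X \<ge> 4\<close>, both \<open>d \<ge> X - 1\<close> and \<open>d - 1 \<ge> X - 2\<close> are at least \<open>X/2\<close>.\<close>
        have "X ^ 2 / 4 = X / 2 * (X / 2)" by (simp add: power2_eq_square)
        also have "\<dots> \<le> d * (d - 1)" using d X4 by (intro mult_mono) auto
        finally have dd: "\<beta> / b * ln (real n) / 4 \<le> d * (d - 1)"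
          by (intro order_trans[OF divide_right_mono[OF X2]]) auto
        have "3 * p * ln (real n) = (48 * p / \<beta> * b) * (\<beta> / b * ln (real n) / 4) / 4"
          using assms b by (simp add: field_simps)
        also have "\<dots> \<le> s * (d * (d - 1)) / 4"
          using s dd assms b ln_n by (intro divide_right_mono mult_mono) (auto intro: order_trans[rotated])
        also have "\<dots> \<le> decay_exponent q n k"
          unfolding s_def d_def q_def using assms True by (intro decay_exponent_near) auto
        finally show ?thesis using lhs by linarith
      next
        case False
        have "ln (real n) \<le> ln (real (k + 1))" using False n by simp
        then have "p * ln (real (k + 1)) + p * ln (real n) \<le> 2 * p * ln (real (k + 1))"
          using assms(4) mult_left_mono[of "ln (real n)" "ln (real (k + 1))" p] by simp
        also have "ln (real (k + 1)) \<le> 2 * sqrt (real k)"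
        proof -
          have "ln (real (k + 1)) = 2 * ln (sqrt (real (k + 1)))" by (simp add: ln_sqrt)
          also have "\<dots> \<le> 2 * (sqrt (real (k + 1)) - 1)"
            by (intro mult_left_mono ln_le_minus_one) auto
          also have "\<dots> \<le> 2 * sqrt (real k)"
            using sqrt_add_le_add_sqrt[of "real k" 1] by (simp add: add.commute)
          finally show ?thesis .
        qed
        also have "2 * p * (2 * sqrt (real k)) = 64 * p * sqrt (real k) / 16" by simp
        also have "\<dots> \<le> (sqrt (real n) * real n * s) * sqrt (real k) / 16"
          using s by (intro divide_right_mono mult_right_mono) auto
        also have "\<dots> \<le> (sqrt (real k) * real n * s) * sqrt (real k) / 16"
          using iterated_log_slope_pos[of "\<delta> / 2" "2 * real n"] assms False
          by (intro divide_right_mono mult_right_mono) (auto simp: s_def)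
        also have "\<dots> = s * real n * real k / 16" by simp
        also have "\<dots> \<le> decay_exponent q n k"
          unfolding s_def q_def using assms False n by (intro decay_exponent_far) auto
        finally show ?thesis using assms(4) by simp
      qed
      then have "exp (p * ln (real (k + 1)) - decay_exponent q n k) \<le> exp (- p * ln (real n))"
        by simp
      then show "real (k + 1) powr p * exp (- decay_exponent q n k) \<le> real n powr - p"
        using n by (simp add: powr_def exp_diff exp_minus field_simps)
    qed
  qed
qed

section \<open>The tail of the Wilson series\<close>

lemma cmod_term_eq_wilson_term:
  assumes "0 < r"
  shows "cmod (a k * wilson_tau k (complex_of_real r)) = wilson_term a r k"
proof -
  have "cmod (- (of_nat j)\<^sup>2 - complex_of_real r) = r + (real j)\<^sup>2" for j
  proof -
    have "- (of_nat j)\<^sup>2 - complex_of_real r = of_real (- (r + (real j)\<^sup>2))" by simp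
    moreover have "\<bar>- (r + (real j)\<^sup>2)\<bar> = r + (real j)\<^sup>2"
      using assms add_pos_nonneg[of r "(real j)\<^sup>2"] by simp
    ultimately show ?thesis by (simp only: norm_of_real)
  qed
  then show ?thesis by (simp add: wilson_tau_def wilson_term_def norm_mult prod_norm[symmetric])
qed

lemma nat_rpow_bounds: "0 \<le> nat_rpow k h" "nat_rpow k h \<le> real (k + 1) powr \<bar>h\<bar>"
proof -
  show "0 \<le> nat_rpow k h" by (simp add: nat_rpow_def)
  show "nat_rpow k h \<le> real (k + 1) powr \<bar>h\<bar>"
  proof (cases "k = 0")
    case False
    then have "real k powr h \<le> real k powr \<bar>h\<bar>" by (intro powr_mono) auto
    also have "\<dots> \<le> real (k + 1) powr \<bar>h\<bar>" by (intro powr_mono2) auto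
    finally show ?thesis by (auto simp: nat_rpow_def)
  qed (simp add: nat_rpow_def)
qed

lemma inverse_squares_summable_on: "(\<lambda>k. 1 / (real (k + 1))\<^sup>2) summable_on UNIV"
  using inverse_squares_sums
  by (subst summable_on_UNIV_nonneg_real_iff) (auto simp: sums_iff add.commute)

text \<open>
  As \<open>b\<close> lies between \<open>1/n^2\<close> and \<open>1/n\<close>, the comparison function is bounded below by a power of \<open>n\<close>
  that depends only on \<open>h\<close> and \<open>\<omega>\<close>.
\<close>
lemma target_lower_bound:
  fixes h \<omega> b :: real
  assumes "1 \<le> n" "1 / real n ^ 2 \<le> b" "b \<le> 1 / real n"
  shows "real n powr (- (\<bar>h\<bar> + \<bar>\<omega> - 1\<bar>)) \<le> real n powr h * b powr ((\<omega> - 1) / 2)"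
proof -
  have "0 < 1 / real n ^ 2" using assms(1) by simp
  then have b: "0 < b" using assms(2) by linarith
  have "1 / real n \<le> 1" using assms(1) by simp
  then have b1: "b \<le> 1" using assms(3) by linarith
  have "real n powr (- \<bar>\<omega> - 1\<bar>) = (1 / real n ^ 2) powr (\<bar>\<omega> - 1\<bar> / 2)"
    using assms(1) by (simp add: powr_divide powr_minus_divide powr_powr flip: powr_numeral)
  also have "\<dots> \<le> b powr (\<bar>\<omega> - 1\<bar> / 2)"
    using assms by (intro powr_mono2) auto
  also have "\<dots> \<le> b powr ((\<omega> - 1) / 2)"
    using b b1 by (intro powr_mono' divide_right_mono abs_ge_self) auto
  finally have "real n powr (- \<bar>\<omega> - 1\<bar>) \<le> b powr ((\<omega> - 1) / 2)" .
  moreover have "real n powr (- \<bar>h\<bar>) \<le> real n powr h"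
    using assms(1) by (intro powr_mono) auto
  ultimately have "real n powr (- \<bar>h\<bar>) * real n powr (- \<bar>\<omega> - 1\<bar>) \<le> real n powr h * b powr ((\<omega> - 1) / 2)"
    by (intro mult_mono) auto
  then show ?thesis by (simp add: powr_add[symmetric])
qed

text \<open>
  Two of the \<open>p\<close> powers of \<open>k + 1\<close> are kept as the convergent majorant \<open>1/(k + 1)^2\<close>, the others absorb
  \<open>k^h\<close>. Of the resulting factor \<open>n^(-p)\<close> one power of \<open>1/n\<close> makes the ratio to the comparison function
  tend to 0.
\<close>
lemma tail_sum_small:
  fixes \<mu> h \<omega> p b c S :: real
  assumes n: "1 \<le> n" "S / c \<le> real n" and b: "1 / real n ^ 2 \<le> b" "b \<le> 1 / real n"
    and "0 < c" "0 < \<mu>"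
    and S: "S = (\<Sum>\<^sub>\<infinity>k. 1 / (real (k + 1))\<^sup>2)"
    and p: "p = \<bar>h\<bar> + \<bar>\<omega> - 1\<bar> + 2"
    and T: "\<And>k. 0 \<le> T k" "\<And>k. T k \<le> \<mu> * D k"
    and D: "\<And>k. k \<in> I \<Longrightarrow> real (k + 1) powr p * D k \<le> real n powr - p"
  shows "(\<lambda>k. nat_rpow k h * T k) summable_on I"
    and "(\<Sum>\<^sub>\<infinity>k\<in>I. nat_rpow k h * T k) \<le> c * (\<mu> * real n powr h * b powr ((\<omega> - 1) / 2))"
proof -
  define g where "g k = \<mu> * real n powr - p * (1 / (real (k + 1))\<^sup>2)" for k
  have g: "g summable_on UNIV"
    unfolding g_def by (intro summable_on_cmult_right inverse_squares_summable_on)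
  have le: "nat_rpow k h * T k \<le> g k" if "k \<in> I" for k
  proof -
    have D0: "0 \<le> D k"
      using order_trans[OF T] \<open>0 < \<mu>\<close> by (simp add: zero_le_mult_iff)
    have "nat_rpow k h * T k \<le> real (k + 1) powr \<bar>h\<bar> * (\<mu> * D k)"
      by (intro mult_mono T nat_rpow_bounds) auto
    also have "\<dots> \<le> real (k + 1) powr (p - 2) * (\<mu> * D k)"
      unfolding p using D0 \<open>0 < \<mu>\<close> by (intro mult_right_mono powr_mono) auto
    also have "\<dots> = \<mu> * (real (k + 1) powr p * D k) * (1 / (real (k + 1))\<^sup>2)"
      by (simp add: powr_diff)
    also have "\<dots> \<le> g k"
      unfolding g_def using \<open>0 < \<mu>\<close> by (intro mult_right_mono mult_left_mono D that) auto
    finally show ?thesis .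
  qed
  have nonneg: "0 \<le> nat_rpow k h * T k" for k
    by (intro mult_nonneg_nonneg nat_rpow_bounds T)
  show summable: "(\<lambda>k. nat_rpow k h * T k) summable_on I"
    using summable_on_subset_banach[OF g, of I] le nonneg
    by (rule summable_on_comparison_test) auto
  have "(\<Sum>\<^sub>\<infinity>k\<in>I. nat_rpow k h * T k) \<le> (\<Sum>\<^sub>\<infinity>k. g k)"
    using \<open>0 < \<mu>\<close> by (intro infsum_mono_neutral summable g) (auto simp: le, auto simp: g_def)
  also have "\<dots> = \<mu> * real n powr - p * S"
    unfolding g_def S by (rule infsum_cmult_right) (use inverse_squares_summable_on in auto)
  also have "\<dots> \<le> \<mu> * real n powr - p * (c * real n)"
    using n(2) \<open>0 < c\<close> \<open>0 < \<mu>\<close> by (intro mult_left_mono) (auto simp: field_simps)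
  also have "\<dots> = c * \<mu> * real n powr (1 - p)"
    using n(1) by (simp add: powr_diff powr_minus field_simps)
  also have "\<dots> \<le> c * \<mu> * real n powr (- (\<bar>h\<bar> + \<bar>\<omega> - 1\<bar>))"
    unfolding p using n(1) \<open>0 < c\<close> \<open>0 < \<mu>\<close> by (intro mult_left_mono powr_mono) auto
  also have "\<dots> \<le> c * \<mu> * (real n powr h * b powr ((\<omega> - 1) / 2))"
    using \<open>0 < c\<close> \<open>0 < \<mu>\<close> by (intro mult_left_mono target_lower_bound n b) auto
  finally show "(\<Sum>\<^sub>\<infinity>k\<in>I. nat_rpow k h * T k) \<le> c * (\<mu> * real n powr h * b powr ((\<omega> - 1) / 2))"
    by (simp add: mult_ac)
qed

theorem theorem3p2:
  fixes f :: "complex \<Rightarrow> complex" and a :: "nat \<Rightarrow> complex" and \<gamma> \<delta> :: real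
  assumes "transcendental_entire f"
    and "growth_order f < ereal (1 / 3)"
    and "wilson_expansion f a"
    and "3 < \<gamma>" and "ereal \<gamma> < 1 / growth_order f"
    and "\<delta> > 0"
  shows "\<exists>E. E \<subseteq> {1..} \<and> E \<in> sets lebesgue \<and> log_measure E < \<infinity> \<and>
    (\<forall>h \<beta> \<omega> :: real. 0 < \<omega> \<and> \<omega> < \<beta> \<longrightarrow>
      (let N = wilson_central_index a;
           I = (\<lambda>r. tail_indices h (N r) (wilson_kappa \<delta> \<beta> (N r)));
           t = (\<lambda>r k. nat_rpow k h * cmod (a k * wilson_tau k (complex_of_real r)));
           F = inf at_top (principal ({0<..} - E))
       in (\<forall>\<^sub>F r in F. t r summable_on I r) \<and>
          (\<lambda>r. \<Sum>\<^sub>\<infinity>k\<in>I r. t r k) \<in>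
            o[F](\<lambda>r. wilson_max_term a r * real (N r) powr h
                        * wilson_b \<delta> (N r) powr ((\<omega> - 1) / 2))))"
proof -
  define q where "q n = iterated_log_weight (\<delta> / 2) (real n)" for n
  have hol: "f holomorphic_on UNIV" using assms(1) by (simp add: transcendental_entire_def)
  interpret weighted_wilson_terms a q
  proof
    show "\<exists>k\<ge>n. a k \<noteq> 0" for n by (rule wilson_coefficients_nonzero[OF assms(3,1)])
    show "\<forall>\<^sub>F k in sequentially. cmod (a k) \<le> (1 / (8 * real k ^ 3)) ^ k"
      by (rule wilson_coefficients_small[OF assms(3) hol assms(2)])
  qed (use assms(6) in \<open>auto simp: q_def intro!: iterated_log_weight_mono iterated_log_weight_bounds\<close>)
  obtain E where E: "E \<subseteq> {1..}" "E \<in> sets lebesgue" "log_measure E < \<infinity>"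
    and normal: "\<And>m. \<forall>\<^sub>F r in at_top. r \<notin> E \<longrightarrow> (\<exists>n\<ge>m. wilson_central_index a r = n
        \<and> 0 < wilson_max_term a r
        \<and> (\<forall>k. wilson_term a r k \<le> wilson_max_term a r * exp (- decay_exponent q n k)))"
    using normal_radii by blast
  \<comment> \<open>For each ratio \<open>c\<close> the bounds hold once the central index is large; it is large at all
    large radii outside \<open>E\<close>.\<close>
  have key: "\<forall>\<^sub>F r in inf at_top (principal ({0<..} - E)).
      let N = wilson_central_index a r; I = tail_indices h N (wilson_kappa \<delta> \<beta> N);
          t = (\<lambda>k. nat_rpow k h * cmod (a k * wilson_tau k (complex_of_real r)))
      in t summable_on I \<and> 0 < wilson_max_term a r \<and>
         (\<Sum>\<^sub>\<infinity>k\<in>I. t k) \<le> c * (wilson_max_term a r * real N powr h * wilson_b \<delta> N powr ((\<omega> - 1) / 2))"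
    if "0 < \<beta>" "0 < c" for h \<beta> \<omega> c :: real
  proof -
    define S where "S = (\<Sum>\<^sub>\<infinity>k. 1 / (real (k + 1))\<^sup>2)"
    define p where "p = \<bar>h\<bar> + \<bar>\<omega> - 1\<bar> + 2"
    have "0 < p" unfolding p_def by linarith
    have "\<forall>\<^sub>F n in sequentially. S / c \<le> real n" by real_asymp
    then have "\<forall>\<^sub>F n in sequentially. 1 \<le> n \<and> S / c \<le> real n
        \<and> 1 / real n ^ 2 \<le> wilson_b \<delta> n \<and> wilson_b \<delta> n \<le> 1 / real n
        \<and> (\<forall>k. wilson_kappa \<delta> \<beta> n \<le> \<bar>int k - int n\<bar> \<longrightarrow>
              real (k + 1) powr p * exp (- decay_exponent q n k) \<le> real n powr - p)"
      using tail_terms_superpolynomially_small[OF assms(6) that(1) \<open>0 < p\<close>]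
        wilson_b_bounds[OF assms(6)] eventually_ge_at_top[of 1]
      unfolding q_def by eventually_elim simp
    then obtain m where m: "\<And>n. n \<ge> m \<Longrightarrow> 1 \<le> n \<and> S / c \<le> real n
        \<and> 1 / real n ^ 2 \<le> wilson_b \<delta> n \<and> wilson_b \<delta> n \<le> 1 / real n
        \<and> (\<forall>k. wilson_kappa \<delta> \<beta> n \<le> \<bar>int k - int n\<bar> \<longrightarrow>
              real (k + 1) powr p * exp (- decay_exponent q n k) \<le> real n powr - p)"
      by (auto simp: eventually_sequentially)
    show ?thesis
      unfolding eventually_inf_principal
      using normal[of m]
    proof eventually_elim
      case (elim r)
      show ?case
      proof
        assume "r \<in> {0<..} - E"
        then have r: "0 < r" "r \<notin> E" by auto
        define N where "N = wilson_central_index a r"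
        have N: "N \<ge> m" "0 < wilson_max_term a r"
          "\<And>k. wilson_term a r k \<le> wilson_max_term a r * exp (- decay_exponent q N k)"
          using elim r by (auto simp: N_def)
        have T: "0 \<le> wilson_term a r k" for k
          using r by (simp flip: cmod_term_eq_wilson_term)
        have D: "real (k + 1) powr p * exp (- decay_exponent q N k) \<le> real N powr - p"
          if "k \<in> tail_indices h N (wilson_kappa \<delta> \<beta> N)" for k
          using that m[OF N(1)] by (simp add: tail_indices_def)
        show "let N = wilson_central_index a r; I = tail_indices h N (wilson_kappa \<delta> \<beta> N);
            t = (\<lambda>k. nat_rpow k h * cmod (a k * wilson_tau k (complex_of_real r)))
          in t summable_on I \<and> 0 < wilson_max_term a r \<and>
           (\<Sum>\<^sub>\<infinity>k\<in>I. t k) \<le> c * (wilson_max_term a r * real N powr h * wilson_b \<delta> N powr ((\<omega> - 1) / 2))"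
          unfolding Let_def N_def[symmetric] cmod_term_eq_wilson_term[OF r(1)]
          using m[OF N(1)] that(2) N
          by (intro conjI tail_sum_small[OF _ _ _ _ _ _ S_def p_def T N(3) D]) auto
      qed
    qed
  qed
  show ?thesis
  proof (intro exI[of _ E] conjI E allI impI)
    fix h \<beta> \<omega> :: real
    assume "0 < \<omega> \<and> \<omega> < \<beta>"
    then have \<beta>: "0 < \<beta>" by linarith
    show "let N = wilson_central_index a;
           I = (\<lambda>r. tail_indices h (N r) (wilson_kappa \<delta> \<beta> (N r)));
           t = (\<lambda>r k. nat_rpow k h * cmod (a k * wilson_tau k (complex_of_real r)));
           F = inf at_top (principal ({0<..} - E))
       in (\<forall>\<^sub>F r in F. t r summable_on I r) \<and>
          (\<lambda>r. \<Sum>\<^sub>\<infinity>k\<in>I r. t r k) \<in>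
            o[F](\<lambda>r. wilson_max_term a r * real (N r) powr h
                        * wilson_b \<delta> (N r) powr ((\<omega> - 1) / 2))"
      unfolding Let_def
    proof (intro conjI landau_o.smallI)
      show "\<forall>\<^sub>F r in inf at_top (principal ({0<..} - E)).
          (\<lambda>k. nat_rpow k h * cmod (a k * wilson_tau k (complex_of_real r))) summable_on
            tail_indices h (wilson_central_index a r) (wilson_kappa \<delta> \<beta> (wilson_central_index a r))"
        using key[OF \<beta> zero_less_one, of h 0] by eventually_elim (simp add: Let_def)
      fix c :: real assume "0 < c"
      show "\<forall>\<^sub>F r in inf at_top (principal ({0<..} - E)).
          norm (\<Sum>\<^sub>\<infinity>k\<in>tail_indices h (wilson_central_index a r) (wilson_kappa \<delta> \<beta> (wilson_central_index a r)).
              nat_rpow k h * cmod (a k * wilson_tau k (complex_of_real r)))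
          \<le> c * norm (wilson_max_term a r * real (wilson_central_index a r) powr h
              * wilson_b \<delta> (wilson_central_index a r) powr ((\<omega> - 1) / 2))"
        using key[OF \<beta> \<open>0 < c\<close>, of h \<omega>]
        by eventually_elim
          (simp add: Let_def abs_mult infsum_nonneg nat_rpow_bounds)
    qed
  qed
qed

end
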